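(* Let $(W,W')$ be an exchangeable pair of real random variables and set $\Delta = W - W'$. Suppose that $$E(W-W'\mid W) = g(W) + r(W)$$ for a differentiable function $g:\mathbb{R}\to\mathbb{R}$ and a measurable function $r$. Let $c_0>0$ be a constant, let $G(t)=\int_0^t g(s)\,ds$, assume $\int_{-\infty}^\infty e^{-c_0G(t)}dt<\infty$, let $c_1 = 1/\int_{-\infty}^\infty e^{-c_0 G(t)}\,dt$, and let $Y$ be a random variable with density $p(t) = c_1 e^{-c_0 G(t)}$ on $\mathbb{R}$. Let $h$ be absolutely continuous with $\|h'\| = \sup_x|h'(x)|<\infty$. Consider the conditions: (H1) $g$ is non-decreasing, $g(t)\ge 0$ for $t>0$ and $g(t)\le 0$ for $t\le 0$; (H2) there is $c_2<\infty$ such that for all $x$, $\min\big(1/c_1, 1/|c_0 g(x)|\big)\,(|x| + 3/c_1)\,\max(1, c_0|g'(x)|) \le c_2$; (H3) there is $c_3<\infty$ such that for all $x$, $\min\big(1/c_1, 1/|c_0 g(x)|\big)\,(|x| + 3/c_1)\, c_0|g'(x)| \le c_3$. (i) If (H1) and (H2) hold, then $$|Eh(W)-Eh(Y)| \le \|h'\|\Big\{\frac{1+c_2}{c_1}\,E\big|1-(c_0/2)E(\Delta^2\mid W)\big| + \frac12 c_0(1+c_2)E|\Delta|^3 + c_0c_2\,E|r(W)|\Big\}.$$ (ii) If (H1) and (H3) hold, then $$|Eh(W)-Eh(Y)| \le \|h'\|\Big\{\frac{1+c_3}{c_1}\,E\big|1-(c_0/2)E(\Delta^2\mid W)\big| +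 \frac12 c_0(1+c_3)E|\Delta|^3 + \frac{c_0}{c_1}E\Big(\big(|W|+\tfrac{3}{c_1}\big)|r(W)|\Big)\Big\}.$$
   Context: A pair $(W,W')$ is exchangeable if $(W,W')$ and $(W',W)$ have the same joint distribution. In (H2) and (H3), $1/|c_0g(x)|$ is interpreted as $+\infty$ when $g(x)=0$. *)

theory Defs
  imports "HOL-Probability.Probability"
begin

definition abs_cont_on :: "real set \<Rightarrow> (real \<Rightarrow> real) \<Rightarrow> bool" where
  "abs_cont_on S f \<longleftrightarrow>
     (\<forall>\<epsilon>>0. \<exists>\<delta>>0. \<forall>(n::nat) (a::nat \<Rightarrow> real) b.
        (\<forall>i<n. a i \<le> b i \<and> {a i..b i} \<subseteq> S) \<and>
        (\<forall>i<n. \<forall>j<n. i \<noteq> j \<longrightarrow> b i \<le> a j \<or> b j \<le> a i) \<and>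
        (\<Sum>i<n. b i - a i) < \<delta>
        \<longrightarrow> (\<Sum>i<n. \<bar>f (b i) - f (a i)\<bar>) < \<epsilon>)"

definition abs_cont :: "(real \<Rightarrow> real) \<Rightarrow> bool" where
  "abs_cont f \<longleftrightarrow> (\<forall>a b. abs_cont_on {a..b} f)"

text \<open>The factor min(1/c1, 1/|c0 g(x)|), with 1/|c0 g(x)| read as +infinity when g(x)=0.\<close>
definition min_factor :: "real \<Rightarrow> real \<Rightarrow> real \<Rightarrow> real" where
  "min_factor c0 c1 gx = (if gx = 0 then 1 / c1 else min (1 / c1) (1 / \<bar>c0 * gx\<bar>))"

end

theory Submission
  imports Defs
begin

text \<open>
  Write \<open>E = exp (- c0 G)\<close>, \<open>I = \<integral>E = 1 / c1\<close> and \<open>m = \<E> h(Y)\<close>.  The function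
  \<open>f w = (\<integral>\<^bsub>x \<le> w\<^esub> (h - m) E) / E w\<close> solves the Stein equation \<open>f' = c0 g f + h - m\<close>.
  Exchangeability gives \<open>2 \<E> f(W) (g + r)(W) = \<E> \<Delta> (f(W) - f(W'))\<close>, and a first-order Taylor
  expansion of \<open>f\<close> at \<open>W\<close> bounds \<open>\<E> h(W) - m\<close> by \<open>sup |f'|\<close>, the Lipschitz constant of \<open>f'\<close> and
  \<open>\<E> |f(W) r(W)|\<close>.

  All bounds on \<open>f\<close> come from the right tail \<open>T\<close> of \<open>E\<close>: monotonicity of \<open>g\<close> yields
  \<open>T \<le> min (I, 1 / (c0 g)) E\<close> on the positive half-line, hence a bound on \<open>f\<close>; the same comparison
  applied to \<open>(f' E)' = (c0 g' f + h') E\<close> bounds \<open>f'\<close>, and then \<open>f'' = c0 g f' + c0 g' f + h'\<close>.  The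
  negative half-line follows by the reflection \<open>g(t) \<mapsto> - g(-t)\<close>, \<open>f(t) \<mapsto> - f(-t)\<close>.  Since \<open>h'\<close>
  exists only almost everywhere and \<open>g'\<close> need not be continuous, these differential inequalities are
  integrated through a pointwise bound on difference quotients instead of the fundamental theorem
  of calculus.
\<close>

section \<open>Increments from local bounds; absolute continuity\<close>

text \<open>A mean value inequality for a function \<open>B\<close> that need not have a derivative:
  by bisection the local bounds on its increments add up over \<open>{a..b}\<close>, and the slack
  is then sent to 0. It is applied below to expressions containing \<open>h\<close>, where only the
  Lipschitz property is at hand.\<close>

lemma abs_diff_le_if_local_bound:
  fixes B S k :: "real \<Rightarrow> real"
  assumes "a \<le> b"
    and S: "\<And>x. a \<le> x \<Longrightarrow> x \<le> b \<Longrightarrow> (S has_real_derivative k x) (at x)"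
    and loc: "\<And>x e. a \<le> x \<Longrightarrow> x \<le> b \<Longrightarrow> 0 < e \<Longrightarrow>
      eventually (\<lambda>y. \<bar>B y - B x\<bar> \<le> (k x + e) * \<bar>y - x\<bar>) (at x)"
  shows "\<bar>B b - B a\<bar> \<le> S b - S a"
proof -
  \<comment> \<open>One \<open>e\<close> is the slack in the local bound on \<open>B\<close>; the
    other pays for replacing \<open>k x\<close> by a difference quotient of
    \<open>S\<close>.\<close>
  have main: "\<bar>B b - B a\<bar> \<le> S b - S a + 2 * e * (b - a)" if "e > 0" for e
    using \<open>a \<le> b\<close>
  proof (induct rule: Bolzano)
    case (trans a b c)
    then show ?case by (simp add: algebra_simps)
  next
    case (local x)
    have "((\<lambda>y. (S y - S x) / (y - x)) \<longlongrightarrow> k x) (at x)"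
      using S[OF local] by (simp add: has_field_derivative_iff)
    then have "eventually (\<lambda>y. dist ((S y - S x) / (y - x)) (k x) < e) (at x)"
      using \<open>e > 0\<close> by (rule tendstoD)
    with loc[OF local \<open>e > 0\<close>]
    have "eventually (\<lambda>y. \<bar>B y - B x\<bar> \<le> (k x + e) * \<bar>y - x\<bar> \<and>
        dist ((S y - S x) / (y - x)) (k x) < e) (at x)"
      by (rule eventually_conj)
    then obtain d where "d > 0" and d:
      "\<And>y. y \<noteq> x \<Longrightarrow> dist y x < d \<Longrightarrow> \<bar>B y - B x\<bar> \<le> (k x + e) * \<bar>y - x\<bar> \<and>
        dist ((S y - S x) / (y - x)) (k x) < e"
      unfolding eventually_at by auto
    have r: "\<bar>B v - B x\<bar> \<le> S v - S x + 2 * e * (v - x)" if "x \<le> v" "v - x < d" for v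
    proof (cases "v = x")
      case False
      then have "v > x" using that by simp
      have D: "\<bar>B v - B x\<bar> \<le> (k x + e) * (v - x)" "\<bar>(S v - S x) / (v - x) - k x\<bar> < e"
        using d[of v] that \<open>v > x\<close> by (auto simp: dist_real_def)
      then have "k x - e \<le> (S v - S x) / (v - x)" by linarith
      then have "(k x - e) * (v - x) \<le> S v - S x" using \<open>v > x\<close> by (simp add: pos_le_divide_eq)
      with D show ?thesis by (simp add: algebra_simps)
    qed simp
    have l: "\<bar>B x - B u\<bar> \<le> S x - S u + 2 * e * (x - u)" if "u \<le> x" "x - u < d" for u
    proof (cases "u = x")
      case False
      then have "u < x" using that by simp
      have D: "\<bar>B u - B x\<bar> \<le> (k x + e) * (x - u)" "\<bar>(S u - S x) / (u - x) - k x\<bar> < e"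
        using d[of u] that \<open>u < x\<close> by (auto simp: dist_real_def)
      then have "k x - e \<le> (S u - S x) / (u - x)" by linarith
      then have "S u - S x \<le> (k x - e) * (u - x)" using \<open>u < x\<close> by (simp add: neg_le_divide_eq)
      with D show ?thesis by (simp add: algebra_simps)
    qed simp
    show ?case
    proof (intro exI[of _ d] conjI \<open>d > 0\<close> allI impI)
      fix u v assume "u \<le> x \<and> x \<le> v \<and> v - u < d"
      then show "\<bar>B v - B u\<bar> \<le> S v - S u + 2 * e * (v - u)"
        using r[of v] l[of u] by (simp add: algebra_simps)
    qed
  qed
  have "((\<lambda>e. S b - S a + 2 * e * (b - a)) \<longlongrightarrow> S b - S a + 2 * 0 * (b - a)) (at_right 0)"
    by (intro tendsto_intros)
  moreover have "eventually (\<lambda>e. \<bar>B b - B a\<bar> \<le> S b - S a + 2 * e * (b - a)) (at_right 0)"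
    using eventually_at_right_less by (rule eventually_mono) (rule main)
  ultimately show ?thesis
    using tendsto_lowerbound[of _ _ "at_right (0::real)"] by force
qed

lemma abs_cont_onE:
  assumes "abs_cont_on S f" "e > 0"
  obtains \<delta> where "\<delta> > 0" "\<And>(n::nat) a b.
        (\<And>i. i < n \<Longrightarrow> a i \<le> b i \<and> {a i..b i} \<subseteq> S) \<Longrightarrow>
        (\<And>i j. i < n \<Longrightarrow> j < n \<Longrightarrow> i \<noteq> j \<Longrightarrow> b i \<le> a j \<or> b j \<le> a i) \<Longrightarrow>
        (\<Sum>i<n. b i - a i) < \<delta> \<Longrightarrow> (\<Sum>i<n. \<bar>f (b i) - f (a i)\<bar>) < e"
proof -
  define Q where "Q n a b \<delta> \<longleftrightarrow> (\<forall>i<n. a i \<le> b i \<and> {a i..b i} \<subseteq> S) \<and>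
        (\<forall>i<n. \<forall>j<n. i \<noteq> j \<longrightarrow> b i \<le> a j \<or> b j \<le> a i) \<and>
        (\<Sum>i<n. b i - a i) < \<delta>" for n :: nat and a b :: "nat \<Rightarrow> real" and \<delta>
  define R where "R n a b e \<longleftrightarrow> (\<Sum>i<n. \<bar>f (b i) - f (a i)\<bar>) < e" for n :: nat and a b :: "nat \<Rightarrow> real" and e
  have "\<forall>e>0. \<exists>\<delta>>0. \<forall>n a b. Q n a b \<delta> \<longrightarrow> R n a b e"
    using assms(1) unfolding abs_cont_on_def Q_def R_def .
  with assms(2) obtain \<delta> where "\<delta> > 0" and Q: "\<And>n a b. Q n a b \<delta> \<Longrightarrow> R n a b e"
    by blast
  show thesis
    by (rule that[OF \<open>\<delta> > 0\<close>], rule Q[unfolded Q_def R_def]) blast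
qed

text \<open>The exceptional null set lies in an open set \<open>U\<close> of measure below the
  \<delta> of absolute continuity. Bisection cuts \<open>{a..b}\<close> into steps: those around
  exceptional points stay in \<open>U\<close> and contribute less than \<open>e\<close> in total,
  all others grow at rate at most \<open>L + e\<close>.\<close>

lemma abs_cont_Lipschitz:
  fixes h h' :: "real \<Rightarrow> real"
  assumes ac: "abs_cont h"
    and deriv: "AE x in lborel. (h has_real_derivative h' x) (at x)"
    and bnd: "\<And>x. \<bar>h' x\<bar> \<le> L"
  shows "\<bar>h y - h x\<bar> \<le> L * \<bar>y - x\<bar>"
proof -
  have main: "\<bar>h b - h a\<bar> \<le> (L + e) * (b - a) + e" if "a \<le> b" "e > 0" for a b e
  proof (rule abs_cont_onE)
    show "abs_cont_on {a..b} h" using ac by (simp add: abs_cont_def)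
    show "e > 0" by fact
    fix \<delta> :: real
    assume "\<delta> > 0" and \<delta>: "\<And>(n::nat) \<alpha> \<beta>.
        (\<And>i. i < n \<Longrightarrow> \<alpha> i \<le> \<beta> i \<and> {\<alpha> i..\<beta> i} \<subseteq> {a..b}) \<Longrightarrow>
        (\<And>i j. i < n \<Longrightarrow> j < n \<Longrightarrow> i \<noteq> j \<Longrightarrow> \<beta> i \<le> \<alpha> j \<or> \<beta> j \<le> \<alpha> i) \<Longrightarrow>
        (\<Sum>i<n. \<beta> i - \<alpha> i) < \<delta> \<Longrightarrow> (\<Sum>i<n. \<bar>h (\<beta> i) - h (\<alpha> i)\<bar>) < e"
    obtain Z where Z: "{x \<in> space lborel. \<not> (h has_real_derivative h' x) (at x)} \<subseteq> Z"
        "emeasure lborel Z = 0" "Z \<in> sets lborel"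
      using AE_E[OF deriv] by blast
    have Zleb: "Z \<in> sets lebesgue" using Z(3) by simp
    obtain U where U: "open U" "Z \<subseteq> U" "(U - Z) \<in> lmeasurable" "emeasure lebesgue (U - Z) < ennreal \<delta>"
      using sets_lebesgue_outer_open[OF Zleb \<open>\<delta> > 0\<close>] by blast
    have Zn: "emeasure lebesgue Z = 0" using Z by simp
    have Ul: "U \<in> sets lebesgue" using U(1) by simp
    have "U = (U - Z) \<union> Z" using U(2) by auto
    then have "emeasure lebesgue U \<le> emeasure lebesgue (U - Z) + emeasure lebesgue Z"
      using emeasure_subadditive[of "U - Z" lebesgue Z] Zleb U(3) by (simp add: fmeasurableD)
    then have eU: "emeasure lebesgue U < ennreal \<delta>" using U(4) Zn by simp
    then have Um: "U \<in> lmeasurable" using Ul by (auto simp: fmeasurable_def intro: less_trans)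
    then have mU: "measure lebesgue U < \<delta>"
      using eU \<open>\<delta> > 0\<close> by (simp add: emeasure_eq_measure2 ennreal_less_iff)
    have iv: "U \<inter> {u..v} \<in> lmeasurable" for u v
      using Um by (intro fmeasurable_Int_fmeasurable) auto
    \<comment> \<open>\<open>C\<close> collects the steps around exceptional points in intervals \<open>[\<alpha> i, \<beta> i]\<close> inside the small open
      set \<open>U\<close>, where absolute continuity applies; all other steps are controlled by \<open>h'\<close>.\<close>
    define C where "C u v n \<alpha> \<beta> \<longleftrightarrow> (\<forall>i<n. u \<le> \<alpha> i \<and> \<alpha> i \<le> \<beta> i \<and> \<beta> i \<le> v) \<and>
        (\<forall>i<n. \<forall>j<n. i \<noteq> j \<longrightarrow> \<beta> i \<le> \<alpha> j \<or> \<beta> j \<le> \<alpha> i) \<and>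
        (\<Sum>i<n. \<beta> i - \<alpha> i) \<le> measure lebesgue (U \<inter> {u..v}) \<and>
        \<bar>h v - h u\<bar> \<le> (L + e) * (v - u) + (\<Sum>i<n. \<bar>h (\<beta> i) - h (\<alpha> i)\<bar>)"
      for u v and n :: nat and \<alpha> \<beta> :: "nat \<Rightarrow> real"
    define P where "P u v \<longleftrightarrow> (\<exists>n \<alpha> \<beta>. C u v n \<alpha> \<beta>)" for u v
    have "P a b" using \<open>a \<le> b\<close>
    proof (induct rule: Bolzano)
      case (trans u v w)
      obtain n \<alpha> \<beta> where "C u v n \<alpha> \<beta>" using trans(1) unfolding P_def by blast
      note n = this[unfolded C_def, THEN conjunct1, rule_format]
        this[unfolded C_def, THEN conjunct2, THEN conjunct1, rule_format]
        this[unfolded C_def, THEN conjunct2, THEN conjunct2, THEN conjunct1]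
        this[unfolded C_def, THEN conjunct2, THEN conjunct2, THEN conjunct2]
      obtain m \<gamma> \<eta> where "C v w m \<gamma> \<eta>" using trans(2) unfolding P_def by blast
      note m = this[unfolded C_def, THEN conjunct1, rule_format]
        this[unfolded C_def, THEN conjunct2, THEN conjunct1, rule_format]
        this[unfolded C_def, THEN conjunct2, THEN conjunct2, THEN conjunct1]
        this[unfolded C_def, THEN conjunct2, THEN conjunct2, THEN conjunct2]
        \<comment> \<open>The two families are concatenated; since the first lies to the left of
          \<open>v\<close> and the second to the right, no new overlap arises.\<close>
        define A where "A = (\<lambda>i. if i < n then \<alpha> i else \<gamma> (i - n))"
        define B where "B = (\<lambda>i. if i < n then \<beta> i else \<eta> (i - n))"
        have s: "(\<Sum>i<n+m. F i) = (\<Sum>i<n. F i) + (\<Sum>i<m. F (n + i))" for F :: "nat \<Rightarrow> real"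
          by (induct m) auto
        have "negligible ((U \<inter> {u..v}) \<inter> (U \<inter> {v..w}))"
          by (rule negligible_subset[of "{v}"]) auto
        then have "measure lebesgue ((U \<inter> {u..v}) \<union> (U \<inter> {v..w})) =
            measure lebesgue (U \<inter> {u..v}) + measure lebesgue (U \<inter> {v..w})"
          by (simp add: measure_Un3[OF iv iv] negligible_imp_measure0)
        moreover have "(U \<inter> {u..v}) \<union> (U \<inter> {v..w}) = U \<inter> {u..w}" using trans(3,4) by auto
        ultimately have ms: "measure lebesgue (U \<inter> {u..w}) =
            measure lebesgue (U \<inter> {u..v}) + measure lebesgue (U \<inter> {v..w})" by simp
        have "u \<le> A i \<and> A i \<le> B i \<and> B i \<le> w" if "i < n + m" for i
          using n(1)[of i] m(1)[of "i - n"] that trans(3,4) unfolding A_def B_def by fastforce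
        moreover have "B i \<le> A j \<or> B j \<le> A i" if "i < n + m" "j < n + m" "i \<noteq> j" for i j
        proof -
          consider "i < n" "j < n" | "i < n" "\<not> j < n" | "\<not> i < n" "j < n" | "\<not> i < n" "\<not> j < n" by blast
          then show ?thesis
          proof cases
            case 1 then show ?thesis using n(2) that by (auto simp: A_def B_def)
          next
            case 2
            then have "\<beta> i \<le> v" "v \<le> \<gamma> (j - n)" using n(1)[of i] m(1)[of "j - n"] that by linarith+
            then show ?thesis using 2 by (simp add: A_def B_def)
          next
            case 3
            then have "\<beta> j \<le> v" "v \<le> \<gamma> (i - n)" using n(1)[of j] m(1)[of "i - n"] that by linarith+
            then show ?thesis using 3 by (simp add: A_def B_def)
          next
            case 4
            then have "i - n < m" "j - n < m" "i - n \<noteq> j - n" using that by linarith+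
            then show ?thesis using m(2)[of "i - n" "j - n"] 4 by (simp add: A_def B_def)
          qed
        qed
        moreover have "(\<Sum>i<n+m. B i - A i) \<le> measure lebesgue (U \<inter> {u..w})"
          unfolding s ms using n(3) m(3) by (simp add: A_def B_def)
        moreover have "\<bar>h w - h u\<bar> \<le> (L + e) * (w - u) + (\<Sum>i<n+m. \<bar>h (B i) - h (A i)\<bar>)"
          unfolding s using n(4) m(4) by (simp add: A_def B_def algebra_simps)
        ultimately have "C u w (n+m) A B" unfolding C_def by blast
        then show ?case unfolding P_def by blast
    next
      case (local x)
      show ?case
      proof (cases "x \<in> Z")
        case True
        then have "x \<in> U" using U(2) by auto
        then obtain d where "d > 0" and d: "ball x d \<subseteq> U"
          using U(1) open_contains_ball by blast
        have "P u v" if "u \<le> x" "x \<le> v" "v - u < d" for u v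
        proof -
          have "{u..v} \<subseteq> U" using that d by (auto simp: subset_iff dist_real_def)
          then have "U \<inter> {u..v} = {u..v}" by auto
          moreover have "L \<ge> 0" using bnd[of 0] by linarith
          ultimately have "C u v 1 (\<lambda>_. u) (\<lambda>_. v)" unfolding C_def using that \<open>e > 0\<close> by auto
          then show ?thesis unfolding P_def by blast
        qed
        then show ?thesis using \<open>d > 0\<close> by blast
      next
        case False
        then have "(h has_real_derivative h' x) (at x)" using Z(1) by auto
        then have "((\<lambda>y. (h y - h x) / (y - x)) \<longlongrightarrow> h' x) (at x)"
          by (simp add: has_field_derivative_iff)
        then have "eventually (\<lambda>y. dist ((h y - h x) / (y - x)) (h' x) < e) (at x)"
          using \<open>e > 0\<close> by (rule tendstoD)
        then obtain d where "d > 0" and d: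
          "\<And>y. y \<noteq> x \<Longrightarrow> dist y x < d \<Longrightarrow> dist ((h y - h x) / (y - x)) (h' x) < e"
          unfolding eventually_at by auto
        have D: "\<bar>h y - h x\<bar> \<le> (L + e) * \<bar>y - x\<bar>" if "\<bar>y - x\<bar> < d" for y
        proof (cases "y = x")
          case False
          then have "\<bar>(h y - h x) / (y - x) - h' x\<bar> < e"
            using d[of y] that by (simp add: dist_real_def)
          then have "\<bar>(h y - h x) / (y - x)\<bar> \<le> L + e" using bnd[of x] by linarith
          then show ?thesis using False by (simp add: abs_divide pos_divide_le_eq)
        qed simp
        have "P u v" if "u \<le> x" "x \<le> v" "v - u < d" for u v
        proof -
          have "\<bar>h v - h u\<bar> \<le> (L + e) * (v - u)"
            using D[of u] D[of v] that by (simp add: algebra_simps)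
          then have "C u v 0 (\<lambda>_. u) (\<lambda>_. v)" unfolding C_def by auto
          then show ?thesis unfolding P_def by blast
        qed
        then show ?thesis using \<open>d > 0\<close> by blast
      qed
    qed
    then obtain n \<alpha> \<beta> where "C a b n \<alpha> \<beta>" unfolding P_def by blast
    note n = this[unfolded C_def, THEN conjunct1, rule_format]
      this[unfolded C_def, THEN conjunct2, THEN conjunct1, rule_format]
      this[unfolded C_def, THEN conjunct2, THEN conjunct2, THEN conjunct1]
      this[unfolded C_def, THEN conjunct2, THEN conjunct2, THEN conjunct2]
    have "measure lebesgue (U \<inter> {a..b}) \<le> measure lebesgue U"
      using iv Um by (intro measure_mono_fmeasurable) auto
    then have "(\<Sum>i<n. \<bar>h (\<beta> i) - h (\<alpha> i)\<bar>) < e"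
      using n(3) mU by (intro \<delta> n(2)) (auto dest: n(1))
    then show "\<bar>h b - h a\<bar> \<le> (L + e) * (b - a) + e" using n(4) by linarith
  qed
  have le: "\<bar>h b - h a\<bar> \<le> L * (b - a)" if "a \<le> b" for a b
  proof -
    have "((\<lambda>e. (L + e) * (b - a) + e) \<longlongrightarrow> (L + 0) * (b - a) + 0) (at_right 0)"
      by (intro tendsto_intros)
    moreover have "eventually (\<lambda>e. \<bar>h b - h a\<bar> \<le> (L + e) * (b - a) + e) (at_right 0)"
      using eventually_at_right_less by (rule eventually_mono) (rule main[OF that])
    ultimately show ?thesis
      using tendsto_lowerbound[of _ _ "at_right (0::real)"] by force
  qed
  show ?thesis using le[of x y] le[of y x] by (cases "x \<le> y") (auto simp: abs_minus_commute)
qed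

section \<open>Integrals with a variable endpoint and comparison at infinity\<close>

lemma interval_integral_has_real_derivative:
  fixes f :: "real \<Rightarrow> real"
  assumes "\<And>x. isCont f x"
  shows "((\<lambda>u. LBINT y=ereal c..ereal u. f y) has_real_derivative f x) (at x)"
proof -
  \<comment> \<open>Padding by 1 puts \<open>x\<close> in the interior, so that the derivative
    within the interval is the full derivative.\<close>
  have "((\<lambda>u. LBINT y=c..u. f y) has_vector_derivative f x) (at x within {min c x - 1..max c x + 1})"
    using assms by (intro interval_integral_FTC2) (auto intro: continuous_at_imp_continuous_on)
  then have "((\<lambda>u. LBINT y=c..u. f y) has_vector_derivative f x) (at x)"
    by (subst (asm) at_within_Icc_at) auto
  then show ?thesis by (simp add: has_real_derivative_iff_has_vector_derivative)
qed

text \<open>Splitting at 0 leaves a constant plus an integral over a bounded interval.\<close>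

lemma integral_atMost_has_real_derivative:
  fixes f :: "real \<Rightarrow> real"
  assumes cont: "\<And>x. isCont f x" and int: "integrable lborel f"
  shows "((\<lambda>w. \<integral>x. indicator {..w} x * f x \<partial>lborel) has_real_derivative f x) (at x)"
proof -
  have eq: "(\<integral>x. indicator {..w} x * f x \<partial>lborel) = (LBINT y=-\<infinity>..ereal w. f y)" for w
  proof -
    have "(LBINT y=-\<infinity>..ereal w. f y) = (LBINT y:{..<w}. f y)"
      by (simp add: interval_lebesgue_integral_def einterval_def lessThan_def)
    also have "\<dots> = (\<integral>x. indicator {..w} x * f x \<partial>lborel)"
      unfolding set_lebesgue_integral_def
      using AE_lborel_singleton[of w] int
      by (intro integral_cong_AE) (auto elim!: eventually_mono split: split_indicator)
    finally show ?thesis by simp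
  qed
  have "(LBINT y=-\<infinity>..ereal 0. f y) + (LBINT y=ereal 0..ereal w. f y) = (LBINT y=-\<infinity>..ereal w. f y)" for w
    using int by (intro interval_integral_sum)
      (auto simp: interval_lebesgue_integrable_def set_integrable_def intro!: integrable_mult_indicator[where 'b=real, simplified])
  then have "(\<lambda>w. \<integral>x. indicator {..w} x * f x \<partial>lborel) =
      (\<lambda>w. (LBINT y=-\<infinity>..ereal 0. f y) + (LBINT y=ereal 0..ereal w. f y))"
    by (simp add: eq)
  then show ?thesis
    using interval_integral_has_real_derivative[of f 0 x] cont
    by (auto intro!: derivative_eq_intros)
qed

text \<open>Supplies the boundary value of \<open>f t * E t\<close> at minus infinity, by dominated
  convergence after \<open>w\<close> is replaced by \<open>- w\<close>.\<close>

lemma integral_atMost_tendsto_at_bot: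
  fixes f :: "real \<Rightarrow> real"
  assumes int: "integrable lborel f"
  shows "((\<lambda>w. \<integral>x. indicator {..w} x * f x \<partial>lborel) \<longlongrightarrow> 0) at_bot"
proof -
  have [measurable]: "f \<in> borel_measurable borel" using borel_measurable_integrable[OF int] by simp
  have "((\<lambda>w. \<integral>x. indicator {..-w} x * f x \<partial>lborel) \<longlongrightarrow> (\<integral>x. 0 \<partial>(lborel :: real measure))) at_top"
  proof (rule integral_dominated_convergence_at_top[where s = "\<lambda>w x. indicator {..-w} x * f x"
        and f = "\<lambda>_. 0" and w = "\<lambda>x. norm (f x)"])
    show "integrable lborel (\<lambda>x. norm (f x))" using int by (rule integrable_norm)
    show "AE x in lborel. ((\<lambda>w. indicator {..- w} x * f x) \<longlongrightarrow> 0) at_top"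
    proof (intro AE_I2 tendsto_eventually)
      fix x :: real
      show "eventually (\<lambda>w. indicator {..- w} x * f x = 0) at_top"
        using eventually_gt_at_top[of "-x"] by eventually_elim auto
    qed
    show "\<forall>\<^sub>F w in at_top. AE x in lborel. norm (indicator {..- w} x * f x) \<le> norm (f x)"
      by (intro always_eventually allI AE_I2) (simp split: split_indicator)
  qed simp_all
  then show ?thesis
    by (simp add: filterlim_at_bot_mirror)
qed

text \<open>As \<open>\<psi>\<close> is nonincreasing, \<open>\<psi> t\<close> dominates
  \<open>\<eta> s\<close> for every later \<open>s\<close>. Working with a minorant
  \<open>\<eta>\<close> instead of a limit of \<open>\<psi>\<close> lets the applications drop
  nonnegative summands whose decay has not been established.\<close>

lemma nonneg_if_deriv_nonpos_and_tail:
  fixes \<psi> \<psi>' \<eta> :: "real \<Rightarrow> real"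
  assumes deriv: "\<And>s. t \<le> s \<Longrightarrow> (\<psi> has_real_derivative \<psi>' s) (at s)"
    and nonpos: "\<And>s. t \<le> s \<Longrightarrow> \<psi>' s \<le> 0"
    and lim: "(\<eta> \<longlongrightarrow> 0) at_top" and le: "\<And>s. t \<le> s \<Longrightarrow> \<eta> s \<le> \<psi> s"
  shows "0 \<le> \<psi> t"
proof (rule tendsto_upperbound[OF lim])
  show "eventually (\<lambda>s. \<eta> s \<le> \<psi> t) at_top"
    using eventually_ge_at_top[of t]
  proof eventually_elim
    case (elim s)
    have "\<psi> s \<le> \<psi> t"
      by (rule DERIV_nonpos_imp_nonincreasing[OF elim]) (use deriv nonpos in blast)
    then show ?case using le[OF elim] by simp
  qed
qed simp

section \<open>Tails of Gibbs densities and the Stein equation\<close>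

text \<open>\<open>E\<close> enters through its differential equation, not as an exponential, so
  that the reflected data of the negative half-line are another instance.\<close>

locale gibbs_right =
  fixes c :: real and g E :: "real \<Rightarrow> real"
  assumes c_pos: "c > 0" and mono_g: "mono g" and g_nonneg: "\<And>t. t \<ge> 0 \<Longrightarrow> g t \<ge> 0"
    and E_pos: "\<And>t. E t > 0" and E_0: "E 0 = 1"
    and E_deriv: "\<And>t. (E has_real_derivative - c * g t * E t) (at t)"
    and E_int: "integrable lborel E"
begin

definition I :: real where "I = (\<integral>x. E x \<partial>lborel)"

text \<open>The right tail integral of \<open>E\<close>, written as a complement so that its
  derivative and its limit follow from those of the integral over \<open>{..t}\<close>.\<close>

definition T :: "real \<Rightarrow> real" where "T t = I - (\<integral>x. indicator {..t} x * E x \<partial>lborel)"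

lemma E_nonneg [simp]: "0 \<le> E t"
  using E_pos by (rule less_imp_le)

lemma E_cont: "isCont E t"
  using E_deriv by (rule DERIV_isCont)

lemma E_meas[measurable]: "E \<in> borel_measurable borel"
  using E_cont by (intro borel_measurable_continuous_onI) (auto intro: continuous_at_imp_continuous_on)

lemma T_deriv: "(T has_real_derivative - E t) (at t)"
  unfolding T_def using integral_atMost_has_real_derivative[OF E_cont E_int]
  by (auto intro!: derivative_eq_intros)

lemma T_cont: "isCont T t"
  using T_deriv by (rule DERIV_isCont)

lemma T_meas[measurable]: "T \<in> borel_measurable borel"
  using T_cont by (intro borel_measurable_continuous_onI) (auto intro: continuous_at_imp_continuous_on)

lemma integrable_indicator_E: "integrable lborel (\<lambda>x. indicator {..t} x * E x)"
  using integrable_mult_indicator[of "{..t}" lborel E] E_int by simp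

lemma T_nonneg: "T t \<ge> 0"
  unfolding T_def I_def using E_int integrable_indicator_E
  by (auto intro!: integral_mono split: split_indicator)

lemma T_le_I: "T t \<le> I"
  unfolding T_def by (auto intro!: integral_nonneg_AE)

lemma T_tendsto: "(T \<longlongrightarrow> 0) at_top"
proof -
  have "((\<lambda>t. I - (\<integral>x. indicator {..t} x * E x \<partial>lborel)) \<longlongrightarrow> I - I) at_top"
    unfolding I_def using tendsto_integral_at_top[OF _ E_int] by (intro tendsto_intros) auto
  then show ?thesis by (simp add: T_def[abs_def])
qed

lemma I_pos: "I > 0"
proof -
  have "T 1 < T 0"
    proof (rule DERIV_neg_imp_decreasing[of 0 1 T])
    show "\<exists>y. (T has_real_derivative y) (at x) \<and> y < 0" for x
      using T_deriv[of x] E_pos[of x] neg_less_0_iff_less by blast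
  qed simp
  then show ?thesis using T_nonneg[of 1] T_le_I[of 0] by simp
qed

lemma E_antimono: "0 \<le> s \<Longrightarrow> s \<le> t \<Longrightarrow> E t \<le> E s"
proof (erule DERIV_nonpos_imp_nonincreasing)
  fix x assume "0 \<le> s" "s \<le> x"
  then have "- c * g x * E x \<le> 0" using g_nonneg[of x] c_pos by simp
  then show "\<exists>y. (E has_real_derivative y) (at x) \<and> y \<le> 0" using E_deriv[of x] by blast
qed

text \<open>For \<open>s >= t\<close>, monotonicity of \<open>g\<close> gives
  \<open>c * g t * E s <= c * g s * E s\<close>, and the right side is minus the derivative of
  \<open>E\<close>; integrate over the tail. In the proof \<open>g t\<close> is frozen while
  \<open>s\<close> runs to infinity.\<close>

lemma tail_le_hazard: "0 \<le> t \<Longrightarrow> c * g t * T t \<le> E t"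
proof -
  assume t: "0 \<le> t"
  have "0 \<le> E t - c * g t * T t"
  proof (rule nonneg_if_deriv_nonpos_and_tail[where \<psi> = "\<lambda>s. E s - c * g t * T s" and
        \<psi>' = "\<lambda>s. - c * g s * E s + c * g t * E s" and \<eta> = "\<lambda>s. - (c * g t * T s)"])
    show "((\<lambda>s. E s - c * g t * T s) has_real_derivative - c * g s * E s + c * g t * E s) (at s)" for s
      using E_deriv T_deriv by (auto intro!: derivative_eq_intros)
    show "- c * g s * E s + c * g t * E s \<le> 0" if "t \<le> s" for s
      using monoD[OF mono_g that] c_pos E_pos[of s] by (simp add: mult_right_mono)
    show "((\<lambda>s. - (c * g t * T s)) \<longlongrightarrow> 0) at_top"
      using tendsto_mult_right_zero[OF T_tendsto, of "c * g t"] tendsto_minus_cancel_left by fastforce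
    show "- (c * g t * T s) \<le> E s - c * g t * T s" for s using E_pos[of s] by simp
  qed
  then show ?thesis by simp
qed

text \<open>If \<open>c * g t\<close> is at least \<open>1 / I\<close>, the hazard bound suffices.
  Otherwise \<open>c * g s\<close> stays below \<open>1 / I\<close> on all of \<open>{0..t}\<close>,
  so \<open>I * E - T\<close> is nondecreasing there and starts at \<open>I - T 0\<close>, which is
  nonnegative.\<close>

lemma tail_le_density: "0 \<le> t \<Longrightarrow> T t \<le> I * E t"
proof (cases "c * g t * I \<ge> 1")
  case True
  assume t: "0 \<le> t"
  have "T t \<le> (c * g t * I) * T t" using mult_right_mono[OF True T_nonneg[of t]] by simp
  also have "\<dots> = I * (c * g t * T t)" by simp
  also have "\<dots> \<le> I * E t" using tail_le_hazard[OF t] I_pos by (intro mult_left_mono) auto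
  finally show ?thesis .
next
  case False
  assume t: "0 \<le> t"
  have "I * E 0 - T 0 \<le> I * E t - T t"
  proof (rule DERIV_nonneg_imp_nondecreasing[OF t])
    fix s assume s: "0 \<le> s" "s \<le> t"
    have "c * g s * I \<le> c * g t * I" using monoD[OF mono_g s(2)] c_pos I_pos by simp
    then have "c * g s * I \<le> 1" using False by simp
    then have "0 \<le> (1 - c * g s * I) * E s" using E_pos[of s] by simp
    moreover have "((\<lambda>t. I * E t - T t) has_real_derivative (1 - c * g s * I) * E s) (at s)"
      using E_deriv T_deriv by (auto intro!: derivative_eq_intros simp: algebra_simps)
    ultimately show "\<exists>y. ((\<lambda>t. I * E t - T t) has_real_derivative y) (at s) \<and> 0 \<le> y" by blast
  qed
  then show ?thesis using E_0 T_le_I[of 0] by simp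
qed

lemma tail_le_min_factor: "0 \<le> t \<Longrightarrow> T t \<le> min_factor c (1 / I) (g t) * E t"
  using tail_le_density[of t] tail_le_hazard[of t] g_nonneg[of t] c_pos
  by (auto simp: min_factor_def min_def field_simps)

text \<open>The derivative \<open>k\<close> of \<open>K x = - ((x + I) * T x)\<close> dominates
  \<open>x * E x\<close>, because \<open>T x <= I * E x\<close>. The moment is therefore at most the
  total increase of \<open>K\<close>, which is at most \<open>- K 0 = I * T 0\<close>.\<close>

lemma first_moment:
  shows "integrable lborel (\<lambda>x. indicator {0..} x * (x * E x))"
    and "(\<integral>x. indicator {0..} x * (x * E x) \<partial>lborel) \<le> I * T 0"
proof -
  define k where "k x = (x + I) * E x - T x" for x
  define K where "K x = - ((x + I) * T x)" for x
  have K_deriv: "(K has_real_derivative k x) (at x)" for x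
    unfolding K_def k_def using T_deriv by (auto intro!: derivative_eq_intros simp: algebra_simps)
  have k_ge: "x * E x \<le> k x" if "0 \<le> x" for x
    using tail_le_density[OF that] by (simp add: k_def algebra_simps)
  have k_nonneg: "0 \<le> k x" if "0 \<le> x" for x
    using k_ge[OF that] E_pos[of x] that by (meson mult_nonneg_nonneg less_imp_le order_trans)
  have K_mono: "K x \<le> K y" if "0 \<le> x" "x \<le> y" for x y
    using that K_deriv k_nonneg by (intro DERIV_nonneg_imp_nondecreasing[of x y K]) (auto intro!: exI)
  have K_le: "K x \<le> 0" if "0 \<le> x" for x
    using that T_nonneg[of x] I_pos unfolding K_def by simp
  \<comment> \<open>Monotonicity and \<open>K x <= 0\<close> yield a limit \<open>l <= 0\<close> at
    infinity, which is what the improper integral of \<open>k\<close> asks for.\<close>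
  define l where "l = Sup (K ` {0..})"
  have bdd: "bdd_above (K ` {0..})" using K_le by (auto intro!: bdd_aboveI[of _ 0])
  have "l \<le> 0" unfolding l_def using K_le by (intro cSup_least) auto
  have lim: "(K \<longlongrightarrow> l) at_top"
  proof (rule increasing_tendsto)
    show "eventually (\<lambda>x. K x \<le> l) at_top"
      using eventually_ge_at_top[of 0] by eventually_elim (auto simp: l_def intro!: cSup_upper bdd)
    fix y assume "y < l"
    then obtain x where x: "0 \<le> x" "y < K x"
      unfolding l_def using less_cSup_iff[OF _ bdd, of y] by auto
    show "eventually (\<lambda>x. y < K x) at_top"
      using eventually_ge_at_top[of x] by eventually_elim (use x K_mono in force)
  qed
  have "(\<integral>\<^sup>+x. ennreal (indicator {0..} x * (x * E x)) \<partial>lborel) \<le> (\<integral>\<^sup>+x. ennreal (k x) * indicator {0..} x \<partial>lborel)"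
    using k_ge by (intro nn_integral_mono) (auto intro!: ennreal_leI split: split_indicator)
  also have "\<dots> = ennreal (l - K 0)"
    by (rule nn_integral_FTC_atLeast) (use K_deriv k_nonneg lim in \<open>auto simp: k_def\<close>)
  also have "\<dots> \<le> ennreal (I * T 0)"
    using \<open>l \<le> 0\<close> by (intro ennreal_leI) (simp add: K_def)
  finally have le: "(\<integral>\<^sup>+x. ennreal (indicator {0..} x * (x * E x)) \<partial>lborel) \<le> ennreal (I * T 0)" .
  have nn: "0 \<le> indicator {0..} x * (x * E x)" for x
    using E_pos[of x] by (auto split: split_indicator)
  show int: "integrable lborel (\<lambda>x. indicator {0..} x * (x * E x))"
    using le nn by (intro integrableI_bounded) (auto intro: le_less_trans)
  have "ennreal (\<integral>x. indicator {0..} x * (x * E x) \<partial>lborel) \<le> ennreal (I * T 0)"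
    using le nn by (subst nn_integral_eq_integral[symmetric]) (use int in auto)
  then show "(\<integral>x. indicator {0..} x * (x * E x) \<partial>lborel) \<le> I * T 0"
    using I_pos T_nonneg[of 0] by (simp add: ennreal_le_iff)
qed

text \<open>Since \<open>E\<close> is nonincreasing on the positive half-line, its mass on
  \<open>{x/2..x}\<close> is at least \<open>(x / 2) * E x\<close>, and that mass is at most
  \<open>T (x / 2)\<close>.\<close>

lemma E_moment_tendsto: "((\<lambda>x. x * E x) \<longlongrightarrow> 0) at_top"
proof (rule tendsto_sandwich[of "\<lambda>_. 0" _ _ "\<lambda>x. 2 * T (x / 2)"])
  show "eventually (\<lambda>x. 0 \<le> x * E x) at_top"
    using eventually_ge_at_top[of 0] by eventually_elim simp
  have "filterlim (\<lambda>x::real. 1 / 2 * x) at_top at_top"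
    by (rule filterlim_tendsto_pos_mult_at_top[OF tendsto_const _ filterlim_ident]) simp
  then have "filterlim (\<lambda>x::real. x / 2) at_top at_top" by simp
  from filterlim_compose[OF T_tendsto this]
  show "((\<lambda>x. 2 * T (x / 2)) \<longlongrightarrow> 0) at_top" by (rule tendsto_mult_right_zero)
  show "eventually (\<lambda>x. x * E x \<le> 2 * T (x / 2)) at_top"
    using eventually_ge_at_top[of 0]
  proof eventually_elim
    case (elim b)
    have "- T (b/2) - E b * (b/2) \<le> - T b - E b * b"
    proof (rule DERIV_nonneg_imp_nondecreasing[where f = "\<lambda>s. - T s - E b * s"])
      fix s assume "b / 2 \<le> s" "s \<le> b"
      then have "0 \<le> E s - E b" using E_antimono[of s b] elim by simp
      moreover have "((\<lambda>s. - T s - E b * s) has_real_derivative E s - E b) (at s)"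
        using T_deriv by (auto intro!: derivative_eq_intros)
      ultimately show "\<exists>y. ((\<lambda>s. - T s - E b * s) has_real_derivative y) (at s) \<and> 0 \<le> y" by blast
    qed (use elim in simp)
    then show ?case using T_nonneg[of b] by (simp add: algebra_simps)
  qed
qed simp

lemma E_tendsto: "(E \<longlongrightarrow> 0) at_top"
proof (rule tendsto_sandwich[OF _ _ tendsto_const E_moment_tendsto])
  show "eventually (\<lambda>x. 0 \<le> E x) at_top" by simp
  show "eventually (\<lambda>x. E x \<le> x * E x) at_top"
    using eventually_ge_at_top[of 1]
  proof eventually_elim
    case (elim x)
    then show ?case using mult_right_mono[OF elim E_nonneg[of x]] by simp
  qed
qed

end

text \<open>Provides the local bounds needed to integrate differential inequalities in which
  \<open>h\<close> occurs. Freezing \<open>h\<close> at \<open>x\<close> leaves a differentiable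
  function with derivative \<open>d\<close>; the rest, \<open>q y * (h y - h x)\<close>, has rate at
  most \<open>q y * L\<close>, close to \<open>q x * L\<close> by continuity of \<open>q\<close>.
  Each part receives half of \<open>e\<close>.\<close>

lemma local_bound_Lipschitz_perturbation:
  fixes q a h :: "real \<Rightarrow> real"
  assumes q: "\<And>y. 0 \<le> q y" "isCont q x"
    and deriv: "((\<lambda>y. q y * (a y + h x)) has_real_derivative d) (at x)"
    and Lip: "\<And>y. \<bar>h y - h x\<bar> \<le> L * \<bar>y - x\<bar>"
    and bound: "\<bar>d\<bar> + q x * L \<le> k" and "0 < e"
  shows "eventually (\<lambda>y. \<bar>q y * (a y + h y) - q x * (a x + h x)\<bar> \<le> (k + e) * \<bar>y - x\<bar>) (at x)"
proof -
  have "((\<lambda>y. (q y * (a y + h x) - q x * (a x + h x)) / (y - x)) \<longlongrightarrow> d) (at x)"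
    using deriv by (simp add: has_field_derivative_iff)
  then have ev1: "eventually (\<lambda>y. dist ((q y * (a y + h x) - q x * (a x + h x)) / (y - x)) d < e / 2) (at x)"
    using \<open>e > 0\<close> by (intro tendstoD) auto
  have "((\<lambda>y. q y * L) \<longlongrightarrow> q x * L) (at x)"
    using q(2) by (intro tendsto_intros) (simp add: isCont_def)
  then have ev2: "eventually (\<lambda>y. q y * L < q x * L + e / 2) (at x)"
    using \<open>e > 0\<close> by (intro order_tendstoD) auto
  have ev3: "eventually (\<lambda>y. y \<noteq> x) (at x)" by (simp add: eventually_at_filter)
  from ev1 ev2 ev3 show ?thesis
  proof eventually_elim
    case (elim y)
    have "\<bar>(q y * (a y + h x) - q x * (a x + h x)) / (y - x)\<bar> \<le> \<bar>d\<bar> + e / 2"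
      using elim(1) unfolding dist_real_def by linarith
    then have 1: "\<bar>q y * (a y + h x) - q x * (a x + h x)\<bar> \<le> (\<bar>d\<bar> + e / 2) * \<bar>y - x\<bar>"
      using elim(3) by (simp add: abs_divide pos_divide_le_eq)
    have "\<bar>q y * (h y - h x)\<bar> \<le> q y * (L * \<bar>y - x\<bar>)"
      using q(1)[of y] Lip[of y] by (simp add: abs_mult mult_left_mono)
    also have "\<dots> \<le> (q x * L + e / 2) * \<bar>y - x\<bar>"
      using mult_right_mono[OF less_imp_le[OF elim(2)], of "\<bar>y - x\<bar>"] by (simp add: mult.assoc)
    finally have 2: "\<bar>q y * (h y - h x)\<bar> \<le> (q x * L + e / 2) * \<bar>y - x\<bar>" .
    have "q y * (a y + h y) - q x * (a x + h x) =
        (q y * (a y + h x) - q x * (a x + h x)) + q y * (h y - h x)"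
      by (simp add: algebra_simps)
    then have "\<bar>q y * (a y + h y) - q x * (a x + h x)\<bar> \<le>
        (\<bar>d\<bar> + e / 2) * \<bar>y - x\<bar> + (q x * L + e / 2) * \<bar>y - x\<bar>"
      using 1 2 by linarith
    also have "\<dots> = (\<bar>d\<bar> + q x * L + e) * \<bar>y - x\<bar>" by (simp add: algebra_simps)
    also have "\<dots> \<le> (k + e) * \<bar>y - x\<bar>" using bound by (intro mult_right_mono) auto
    finally show ?case .
  qed
qed

section \<open>The Stein solution and its derivative on the positive half-line\<close>

lemma min_factor_nonneg: "0 < i \<Longrightarrow> 0 \<le> min_factor c (1 / i) y"
  by (simp add: min_factor_def)

lemma min_factor_le: "min_factor c (1 / i) y \<le> i"
  by (simp add: min_factor_def)

lemma min_factor_mult_le: "0 < c \<Longrightarrow> min_factor c (1 / i) y * (c * \<bar>y\<bar>) \<le> 1"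
  by (auto simp: min_factor_def min_def abs_mult field_simps)

lemma min_factor_minus: "min_factor c i (- y) = min_factor c i y"
  by (simp add: min_factor_def)

text \<open>\<open>f\<close> is described by its differential equation and the decay of
  \<open>f t * E t\<close>, without a formula, because the reflected solution has to satisfy the
  same axioms.\<close>

locale stein_right = gibbs_right +
  fixes f h :: "real \<Rightarrow> real" and m L :: real
  assumes f_deriv: "\<And>t. (f has_real_derivative c * g t * f t + h t - m) (at t)"
    and fE_tendsto: "((\<lambda>t. f t * E t) \<longlongrightarrow> 0) at_top"
    and Lip: "\<And>x y. \<bar>h y - h x\<bar> \<le> L * \<bar>y - x\<bar>"
    and h_dev: "\<And>t. \<bar>h t - m\<bar> \<le> L * (\<bar>t\<bar> + I)"
begin

lemma L_nonneg: "0 \<le> L"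
  using Lip[of 1 0] by simp

text \<open>The derivative of \<open>f * E\<close> is \<open>(h - m) * E\<close>, of size at most
  \<open>L * (s + I) * E s\<close>. The majorant \<open>L * (s + 2 * I) * T s\<close> falls at least
  that fast: the second \<open>I\<close> compensates the product-rule term
  \<open>L * T s <= L * I * E s\<close>. The sign \<open>\<sigma>\<close> covers both halves of the
  absolute value.\<close>

lemma fE_le_tail:
  assumes t: "0 \<le> t"
  shows "\<bar>f t * E t\<bar> \<le> L * (t + 2 * I) * T t"
proof -
  have "0 \<le> L * (t + 2 * I) * T t + \<sigma> * (f t * E t)" if \<sigma>: "\<bar>\<sigma>\<bar> = 1" for \<sigma> :: real
  proof (rule nonneg_if_deriv_nonpos_and_tail[where \<psi> = "\<lambda>t. L * (t + 2 * I) * T t + \<sigma> * (f t * E t)" and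
        \<psi>' = "\<lambda>s. L * T s - L * (s + 2 * I) * E s + \<sigma> * ((h s - m) * E s)" and \<eta> = "\<lambda>s. \<sigma> * (f s * E s)"])
    show "((\<lambda>t. L * (t + 2 * I) * T t + \<sigma> * (f t * E t)) has_real_derivative
        L * T s - L * (s + 2 * I) * E s + \<sigma> * ((h s - m) * E s)) (at s)" for s
      using f_deriv E_deriv T_deriv by (auto intro!: derivative_eq_intros simp: algebra_simps)
    show "((\<lambda>s. \<sigma> * (f s * E s)) \<longlongrightarrow> 0) at_top"
      using fE_tendsto by (rule tendsto_mult_right_zero)
    fix s assume "t \<le> s"
    then have s: "0 \<le> s" using t by simp
    show "\<sigma> * (f s * E s) \<le> L * (s + 2 * I) * T s + \<sigma> * (f s * E s)"
      using L_nonneg s I_pos T_nonneg[of s] by simp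
    have "\<sigma> * ((h s - m) * E s) \<le> \<bar>\<sigma> * ((h s - m) * E s)\<bar>" by simp
    also have "\<dots> = \<bar>h s - m\<bar> * E s" using \<sigma> by (simp add: abs_mult)
    also have "\<dots> \<le> L * (s + I) * E s" using h_dev[of s] s by (intro mult_right_mono) auto
    finally have "\<sigma> * ((h s - m) * E s) \<le> L * (s + I) * E s" .
    moreover have "L * T s \<le> L * (I * E s)"
      using tail_le_density[OF s] L_nonneg by (rule mult_left_mono)
    ultimately show "L * T s - L * (s + 2 * I) * E s + \<sigma> * ((h s - m) * E s) \<le> 0"
      by (simp add: algebra_simps)
  qed
  from this[of 1] this[of "-1"] show ?thesis by simp
qed

lemma f_bound:
  assumes t: "0 \<le> t"
  shows "\<bar>f t\<bar> \<le> L * (min_factor c (1 / I) (g t) * (\<bar>t\<bar> + 3 * I))"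
proof -
  have "\<bar>f t\<bar> * E t = \<bar>f t * E t\<bar>" by (simp add: abs_mult)
  also have "\<dots> \<le> L * (t + 2 * I) * T t" by (rule fE_le_tail[OF t])
  \<comment> \<open>Relaxing \<open>2 * I\<close> to \<open>3 * I\<close> produces the factor that
    occurs in the conditions on \<open>g\<close>.\<close>
  also have "\<dots> \<le> L * (t + 3 * I) * T t"
    using L_nonneg I_pos T_nonneg[of t] by (intro mult_right_mono mult_left_mono) auto
  also have "\<dots> \<le> L * (t + 3 * I) * (min_factor c (1 / I) (g t) * E t)"
    using tail_le_min_factor[OF t] L_nonneg I_pos t by (intro mult_left_mono) auto
  also have "\<dots> = L * (min_factor c (1 / I) (g t) * (\<bar>t\<bar> + 3 * I)) * E t"
    using t by simp
  finally show ?thesis using E_pos[of t] by (simp only: mult_le_cancel_right_pos)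
qed

text \<open>\<open>B\<close> is \<open>f' * E\<close>. Its local growth rate is at most
  \<open>L * (1 + k) * E\<close>, with \<open>f_bound\<close> and the hypothesis on \<open>k\<close>
  controlling \<open>c * g' * f\<close>, and \<open>B\<close> vanishes at infinity. Hence
  \<open>B t\<close> is bounded by \<open>L * (1 + k) * T t\<close>, and the tail comparison turns
  \<open>T t\<close> into \<open>E t\<close>.\<close>

lemma f_deriv_bound:
  assumes t: "0 \<le> t" and g_diff: "\<And>x. g differentiable at x"
    and k: "\<And>x. min_factor c (1 / I) (g x) * (\<bar>x\<bar> + 3 * I) * (c * \<bar>deriv g x\<bar>) \<le> k"
  shows "\<bar>c * g t * f t + h t - m\<bar> \<le> L * (1 + k) * min_factor c (1 / I) (g t)"
proof -
  define B where "B = (\<lambda>s. E s * ((c * g s * f s - m) + h s))"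
  have incr: "\<bar>B b - B t\<bar> \<le> L * (1 + k) * T t - L * (1 + k) * T b" if b: "t \<le> b" for b
  proof -
    have "\<bar>B b - B t\<bar> \<le> (- (L * (1 + k) * T b)) - (- (L * (1 + k) * T t))"
    proof (rule abs_diff_le_if_local_bound[OF b, where k = "\<lambda>x. L * (1 + k) * E x"])
      show "((\<lambda>x. - (L * (1 + k) * T x)) has_real_derivative L * (1 + k) * E x) (at x)" for x
        using T_deriv by (auto intro!: derivative_eq_intros)
      fix x e :: real assume x: "t \<le> x" and "0 < e"
      have g': "(g has_real_derivative deriv g x) (at x)"
        using g_diff[of x] by (simp add: DERIV_deriv_iff_real_differentiable)
      have "\<bar>f x\<bar> * (c * \<bar>deriv g x\<bar>) \<le> L * (min_factor c (1 / I) (g x) * (\<bar>x\<bar> + 3 * I)) * (c * \<bar>deriv g x\<bar>)"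
        using f_bound[of x] x t c_pos by (intro mult_right_mono) auto
      also have "\<dots> \<le> L * k"
        using mult_left_mono[OF k[of x] L_nonneg] by (simp add: mult.assoc)
      finally have fk: "\<bar>f x\<bar> * (c * \<bar>deriv g x\<bar>) \<le> L * k" .
      show "eventually (\<lambda>y. \<bar>B y - B x\<bar> \<le> (L * (1 + k) * E x + e) * \<bar>y - x\<bar>) (at x)"
        unfolding B_def
      proof (rule local_bound_Lipschitz_perturbation[where d = "E x * (c * deriv g x * f x)" and L = L])
        \<comment> \<open>With \<open>h\<close> frozen at \<open>x\<close>, the term
          \<open>c * g x * f' x * E x\<close> cancels against the derivative of \<open>E\<close>,
          leaving only the term with \<open>deriv g x\<close>.\<close>
        show "((\<lambda>y. E y * ((c * g y * f y - m) + h x)) has_real_derivative E x * (c * deriv g x * f x)) (at x)"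
          using E_deriv f_deriv g' by (auto intro!: derivative_eq_intros simp: algebra_simps)
        have "\<bar>E x * (c * deriv g x * f x)\<bar> = E x * (\<bar>f x\<bar> * (c * \<bar>deriv g x\<bar>))"
          using c_pos by (simp add: abs_mult)
        also have "\<dots> \<le> E x * (L * k)" using fk by (intro mult_left_mono) auto
        finally show "\<bar>E x * (c * deriv g x * f x)\<bar> + E x * L \<le> L * (1 + k) * E x"
          by (simp add: algebra_simps)
      qed (use E_cont Lip \<open>0 < e\<close> in auto)
    qed
    then show ?thesis by simp
  qed
  have "0 \<le> min_factor c (1 / I) (g 0) * (\<bar>0\<bar> + 3 * I) * (c * \<bar>deriv g 0\<bar>)"
    using min_factor_nonneg[OF I_pos, of c "g 0"] I_pos c_pos by simp
  then have k_nonneg: "0 \<le> k" using k[of 0] by linarith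
  \<comment> \<open>\<open>g\<close> may be unbounded, but its product with the tail is absorbed by
    \<open>c * g b * T b <= E b\<close>; what remains decays by \<open>E_moment_tendsto\<close> and
    \<open>E_tendsto\<close>.\<close>
  have B_tail: "\<bar>B b\<bar> \<le> L * (2 * (b * E b) + 3 * I * E b)" if b: "0 \<le> b" for b
  proof -
    have "\<bar>c * g b * (f b * E b)\<bar> = c * g b * \<bar>f b * E b\<bar>"
      using c_pos g_nonneg[OF b] by (simp add: abs_mult)
    also have "\<dots> \<le> c * g b * (L * (b + 2 * I) * T b)"
      using c_pos g_nonneg[OF b] fE_le_tail[OF b] by (intro mult_left_mono) auto
    also have "\<dots> = L * (b + 2 * I) * (c * g b * T b)" by simp
    also have "\<dots> \<le> L * (b + 2 * I) * E b"
      using tail_le_hazard[OF b] b L_nonneg I_pos by (intro mult_left_mono) auto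
    finally have 1: "\<bar>c * g b * (f b * E b)\<bar> \<le> L * (b + 2 * I) * E b" .
    have "\<bar>(h b - m) * E b\<bar> = \<bar>h b - m\<bar> * E b" by (simp add: abs_mult)
    also have "\<dots> \<le> L * (b + I) * E b" using h_dev[of b] b by (intro mult_right_mono) auto
    finally have 2: "\<bar>(h b - m) * E b\<bar> \<le> L * (b + I) * E b" .
    have "B b = c * g b * (f b * E b) + (h b - m) * E b" by (simp add: B_def algebra_simps)
    then have "\<bar>B b\<bar> \<le> L * (b + 2 * I) * E b + L * (b + I) * E b" using 1 2 by linarith
    then show ?thesis by (simp add: algebra_simps)
  qed
  have "\<bar>B t\<bar> \<le> L * (1 + k) * T t"
  proof -
    have "((\<lambda>b. L * (1 + k) * T t + L * (2 * (b * E b) + 3 * I * E b)) \<longlongrightarrow>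
        L * (1 + k) * T t + L * (2 * 0 + 3 * I * 0)) at_top"
      by (intro tendsto_intros E_moment_tendsto E_tendsto)
    moreover have "eventually (\<lambda>b. \<bar>B t\<bar> \<le> L * (1 + k) * T t + L * (2 * (b * E b) + 3 * I * E b)) at_top"
      using eventually_ge_at_top[of t]
    proof eventually_elim
      case (elim b)
      have "0 \<le> L * (1 + k) * T b" using L_nonneg k_nonneg T_nonneg[of b] by simp
      then show ?case using incr[OF elim] B_tail[of b] elim t by linarith
    qed
    ultimately show ?thesis
      using tendsto_lowerbound[of _ _ "at_top :: real filter"] by fastforce
  qed
  also have "\<dots> \<le> L * (1 + k) * (min_factor c (1 / I) (g t) * E t)"
    using tail_le_min_factor[OF t] L_nonneg k_nonneg by (intro mult_left_mono) auto
  finally have "\<bar>c * g t * f t + h t - m\<bar> * E t \<le> L * (1 + k) * min_factor c (1 / I) (g t) * E t"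
    by (simp add: B_def abs_mult mult_ac diff_add_eq)
  then show ?thesis using E_pos[of t] by (simp only: mult_le_cancel_right_pos)
qed

end

section \<open>Reflection and the combination of both half-lines\<close>

lemma lborel_integral_reflect:
  fixes f :: "real \<Rightarrow> real"
  shows "(\<integral>x. f (- x) \<partial>lborel) = (\<integral>x. f x \<partial>lborel)"
  using lborel_integral_real_affine[of "-1" f 0] by simp

lemma lborel_integrable_reflect:
  fixes f :: "real \<Rightarrow> real"
  assumes "integrable lborel f"
  shows "integrable lborel (\<lambda>x. f (- x))"
  using lborel_integrable_real_affine[OF assms, of "-1" 0] by simp

lemma DERIV_reflect:
  fixes f :: "real \<Rightarrow> real"
  assumes "(f has_real_derivative d) (at (- x))"
  shows "((\<lambda>y. f (- y)) has_real_derivative - d) (at x)"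
proof -
  have "(uminus has_real_derivative - 1) (at x)"
    by (auto intro!: derivative_eq_intros)
  from DERIV_chain2[OF assms this] show ?thesis by simp
qed

locale gibbs =
  fixes c :: real and g E :: "real \<Rightarrow> real"
  assumes c_pos: "c > 0" and mono_g: "mono g"
    and g_nonneg: "\<And>t. t \<ge> 0 \<Longrightarrow> g t \<ge> 0" and g_nonpos: "\<And>t. t \<le> 0 \<Longrightarrow> g t \<le> 0"
    and E_pos: "\<And>t. E t > 0" and E_0: "E 0 = 1"
    and E_deriv: "\<And>t. (E has_real_derivative - c * g t * E t) (at t)"
    and E_int: "integrable lborel E"
begin

sublocale right: gibbs_right c g E
  by unfold_locales (fact c_pos mono_g E_pos E_0 E_deriv E_int | erule g_nonneg)+

sublocale left: gibbs_right c "\<lambda>t. - g (- t)" "\<lambda>t. E (- t)"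
proof
  show "mono (\<lambda>t. - g (- t))" using mono_g by (auto simp: mono_def)
  show "((\<lambda>t. E (- t)) has_real_derivative - c * - g (- t) * E (- t)) (at t)" for t
    using DERIV_reflect[OF E_deriv[of "- t"]] by simp
  show "integrable lborel (\<lambda>t. E (- t))" by (rule lborel_integrable_reflect[OF E_int])
qed (use c_pos g_nonpos E_pos E_0 in auto)

abbreviation "I \<equiv> right.I"

lemma left_I: "left.I = I"
  unfolding left.I_def right.I_def by (rule lborel_integral_reflect)

text \<open>The two tails at 0 are the masses of the two half-lines, which overlap in a null set.
  This merges the one-sided moment bounds into \<open>I * I\<close>.\<close>

lemma left_T_plus_right_T: "left.T 0 + right.T 0 = I"
proof -
  have int: "integrable lborel (\<lambda>x. indicator {0..} x * E x)"
    using integrable_mult_indicator[of "{0..}" lborel E] E_int by simp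
  have "(\<integral>x. indicator {..0} x * E (- x) \<partial>lborel) = (\<integral>x. indicator {0..} x * E x \<partial>lborel)"
    by (subst lborel_integral_reflect[symmetric])
       (auto intro!: Bochner_Integration.integral_cong split: split_indicator)
  then have "left.T 0 + right.T 0 = 2 * I -
      ((\<integral>x. indicator {0..} x * E x \<partial>lborel) + (\<integral>x. indicator {..0} x * E x \<partial>lborel))"
    unfolding left.T_def right.T_def left_I by simp
  also have "(\<integral>x. indicator {0..} x * E x \<partial>lborel) + (\<integral>x. indicator {..0} x * E x \<partial>lborel) =
      (\<integral>x. indicator {0..} x * E x + indicator {..0} x * E x \<partial>lborel)"
    by (rule Bochner_Integration.integral_add[symmetric]) (fact int right.integrable_indicator_E)+
  also have "\<dots> = I"
    unfolding right.I_def using AE_lborel_singleton[of 0]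
    by (intro integral_cong_AE) (auto elim!: eventually_mono split: split_indicator)
  finally show ?thesis by simp
qed

text \<open>Each half-line contributes at most \<open>I\<close> times its own mass. After
  normalisation this says that the mean of \<open>\<bar>Y\<bar>\<close> is at most
  \<open>I\<close>.\<close>

lemma abs_moment:
  shows "integrable lborel (\<lambda>x. \<bar>x\<bar> * E x)" and "(\<integral>x. \<bar>x\<bar> * E x \<partial>lborel) \<le> I * I"
proof -
  let ?r = "\<lambda>x. indicator {0..} x * (x * E x)"
  let ?l = "\<lambda>x. indicator {0..} (- x) * (- x * E x)"
  have eq: "(\<lambda>x. \<bar>x\<bar> * E x) = (\<lambda>x. ?r x + ?l x)"
    by (auto split: split_indicator)
  have lint: "integrable lborel ?l"
    using lborel_integrable_reflect[OF left.first_moment(1)] by simp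
  show "integrable lborel (\<lambda>x. \<bar>x\<bar> * E x)"
    unfolding eq by (intro Bochner_Integration.integrable_add right.first_moment(1) lint)
  have "(\<integral>x. \<bar>x\<bar> * E x \<partial>lborel) = (\<integral>x. ?r x \<partial>lborel) + (\<integral>x. ?l x \<partial>lborel)"
    unfolding eq by (intro Bochner_Integration.integral_add right.first_moment(1) lint)
  also have "(\<integral>x. ?l x \<partial>lborel) = (\<integral>x. indicator {0..} x * (x * E (- x)) \<partial>lborel)"
    using lborel_integral_reflect[of ?l] by simp
  also have "(\<integral>x. ?r x \<partial>lborel) + \<dots> \<le> I * right.T 0 + I * left.T 0"
    using right.first_moment(2) left.first_moment(2) unfolding left_I by linarith
  also have "\<dots> = I * I"
    using left_T_plus_right_T by (metis add.commute distrib_left)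
  finally show "(\<integral>x. \<bar>x\<bar> * E x \<partial>lborel) \<le> I * I" .
qed

end

section \<open>The Stein solution on the whole line\<close>

locale stein = gibbs +
  fixes h :: "real \<Rightarrow> real" and L :: real
  assumes Lip: "\<And>x y. \<bar>h y - h x\<bar> \<le> L * \<bar>y - x\<bar>"
begin

definition m :: real where "m = (\<integral>x. h x * E x \<partial>lborel) / I"

lemma Lip_isCont: "isCont h x"
proof -
  have "L-lipschitz_on UNIV h"
    using Lip[of 1 0] Lip by (auto simp: lipschitz_on_def dist_real_def)
  then show ?thesis
    by (meson lipschitz_on_continuous_on continuous_on_eq_continuous_at open_UNIV UNIV_I)
qed

lemma hE_integrable: "integrable lborel (\<lambda>x. h x * E x)"
proof (rule Bochner_Integration.integrable_bound)
  show "integrable lborel (\<lambda>x. \<bar>h 0\<bar> * E x + L * (\<bar>x\<bar> * E x))"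
    using E_int abs_moment(1) by auto
  have "h \<in> borel_measurable borel"
    using Lip_isCont by (intro borel_measurable_continuous_onI) (auto intro: continuous_at_imp_continuous_on)
  then show "(\<lambda>x. h x * E x) \<in> borel_measurable lborel" by simp
  have "norm (h x * E x) \<le> norm (\<bar>h 0\<bar> * E x + L * (\<bar>x\<bar> * E x))" for x
  proof -
    have "\<bar>h x\<bar> * E x \<le> (\<bar>h 0\<bar> + L * \<bar>x\<bar>) * E x"
      using Lip[of x 0] by (intro mult_right_mono) auto
    then show ?thesis by (simp add: abs_mult algebra_simps)
  qed
  then show "AE x in lborel. norm (h x * E x) \<le> norm (\<bar>h 0\<bar> * E x + L * (\<bar>x\<bar> * E x))" by simp
qed

text \<open>\<open>h t - m\<close> is the average of \<open>h t - h x\<close> against the density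
  \<open>E x / I\<close>; the integrand is at most
  \<open>L * (\<bar>t\<bar> + \<bar>x\<bar>)\<close>, and the average of
  \<open>\<bar>x\<bar>\<close> is at most \<open>I\<close>.\<close>

lemma mean_deviation: "\<bar>h t - m\<bar> \<le> L * (\<bar>t\<bar> + I)"
proof -
  have L: "0 \<le> L" using Lip[of 1 0] by simp
  have "(h t - m) * I = (\<integral>x. (h t - h x) * E x \<partial>lborel)"
    using E_int hE_integrable right.I_pos
    by (simp add: m_def left_diff_distrib right.I_def[symmetric])
  moreover have "\<bar>h t - m\<bar> * I = \<bar>(h t - m) * I\<bar>"
    using right.I_pos by (simp add: abs_mult)
  ultimately have "\<bar>h t - m\<bar> * I = \<bar>\<integral>x. (h t - h x) * E x \<partial>lborel\<bar>" by simp
  also have "\<dots> \<le> (\<integral>x. \<bar>(h t - h x) * E x\<bar> \<partial>lborel)"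
    by (rule integral_abs_bound)
  also have "\<dots> \<le> (\<integral>x. L * \<bar>t\<bar> * E x + L * (\<bar>x\<bar> * E x) \<partial>lborel)"
  proof (rule integral_mono)
    show "integrable lborel (\<lambda>x. \<bar>(h t - h x) * E x\<bar>)"
      using E_int hE_integrable by (intro integrable_abs) (simp add: left_diff_distrib)
    show "integrable lborel (\<lambda>x. L * \<bar>t\<bar> * E x + L * (\<bar>x\<bar> * E x))"
      using E_int abs_moment(1) by auto
    fix x
    have "L * \<bar>t - x\<bar> \<le> L * (\<bar>t\<bar> + \<bar>x\<bar>)" using L by (intro mult_left_mono) auto
    then have "\<bar>h t - h x\<bar> * E x \<le> L * (\<bar>t\<bar> + \<bar>x\<bar>) * E x"
      using Lip[of t x] by (intro mult_right_mono) auto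
    then show "\<bar>(h t - h x) * E x\<bar> \<le> L * \<bar>t\<bar> * E x + L * (\<bar>x\<bar> * E x)"
      by (simp add: abs_mult distrib_left distrib_right mult.assoc)
  qed
  also have "\<dots> = L * \<bar>t\<bar> * I + L * (\<integral>x. \<bar>x\<bar> * E x \<partial>lborel)"
    using E_int abs_moment(1) by (simp add: right.I_def)
  also have "\<dots> \<le> L * \<bar>t\<bar> * I + L * (I * I)"
    using abs_moment(2) L by (intro add_left_mono mult_left_mono) auto
  also have "\<dots> = L * (\<bar>t\<bar> + I) * I" by (simp add: algebra_simps)
  finally show ?thesis using right.I_pos by (simp only: mult_le_cancel_right_pos)
qed

definition f :: "real \<Rightarrow> real" where
  "f w = (\<integral>x. indicator {..w} x * ((h x - m) * E x) \<partial>lborel) / E w"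

lemma centred_integrable: "integrable lborel (\<lambda>x. (h x - m) * E x)"
  using E_int hE_integrable by (simp add: left_diff_distrib)

lemma f_deriv: "(f has_real_derivative c * g t * f t + h t - m) (at t)"
proof -
  define A where "A w = (\<integral>x. indicator {..w} x * ((h x - m) * E x) \<partial>lborel)" for w
  have "(A has_real_derivative (h t - m) * E t) (at t)"
    unfolding A_def using Lip_isCont right.E_cont
    by (intro integral_atMost_has_real_derivative[OF _ centred_integrable] continuous_intros)
  from DERIV_divide[OF this E_deriv[of t]] E_pos[of t]
  have "((\<lambda>w. A w / E w) has_real_derivative ((h t - m) * E t * E t - A t * (- c * g t * E t)) / (E t * E t)) (at t)"
    by simp
  moreover have "((h t - m) * E t * E t - A t * (- c * g t * E t)) / (E t * E t) = c * g t * (A t / E t) + h t - m"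
    using E_pos[of t] by (simp add: field_simps)
  ultimately show ?thesis unfolding f_def[abs_def] A_def by simp
qed

lemma fE_eq: "f w * E w = (\<integral>x. indicator {..w} x * ((h x - m) * E x) \<partial>lborel)"
  using E_pos[of w] by (simp add: f_def)

text \<open>Decay at plus infinity is where the choice of \<open>m\<close> matters: the total
  integral of \<open>(h - m) * E\<close> is 0.\<close>

sublocale right: stein_right c g E f h m L
proof
  have "((\<lambda>w. \<integral>x. indicator {..w} x *\<^sub>R ((h x - m) * E x) \<partial>lborel) \<longlongrightarrow>
      (\<integral>x. (h x - m) * E x \<partial>lborel)) at_top"
    by (rule tendsto_integral_at_top[OF _ centred_integrable]) simp
  moreover have "(\<integral>x. (h x - m) * E x \<partial>lborel) = 0"
    using E_int hE_integrable right.I_pos by (simp add: left_diff_distrib m_def right.I_def)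
  ultimately show "((\<lambda>t. f t * E t) \<longlongrightarrow> 0) at_top" by (simp add: fE_eq)
qed (fact f_deriv Lip mean_deviation)+

text \<open>The two sign changes cancel, so the derivative of \<open>- f (- t)\<close> is
  \<open>f'\<close> at \<open>- t\<close> and the Stein equation keeps its form with the same
  \<open>m\<close>. Decay now comes from minus infinity, where the defining integral of
  \<open>f\<close> shrinks to 0.\<close>

sublocale left: stein_right c "\<lambda>t. - g (- t)" "\<lambda>t. E (- t)" "\<lambda>t. - f (- t)" "\<lambda>t. h (- t)" m L
proof
  show "((\<lambda>t. - f (- t)) has_real_derivative c * - g (- t) * - f (- t) + h (- t) - m) (at t)" for t
    using DERIV_minus[OF DERIV_reflect[OF f_deriv[of "- t"]]] by simp
  have "((\<lambda>t. f t * E t) \<longlongrightarrow> 0) at_bot"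
    unfolding fE_eq by (rule integral_atMost_tendsto_at_bot[OF centred_integrable])
  then have "((\<lambda>t. f (- t) * E (- t)) \<longlongrightarrow> 0) at_top"
    by (simp add: filterlim_at_bot_mirror)
  from tendsto_minus[OF this] show "((\<lambda>t. - f (- t) * E (- t)) \<longlongrightarrow> 0) at_top" by simp
  show "\<bar>h (- y) - h (- x)\<bar> \<le> L * \<bar>y - x\<bar>" for x y
    using Lip[of "- y" "- x"] by (simp add: abs_minus_commute)
  show "\<bar>h (- t) - m\<bar> \<le> L * (\<bar>t\<bar> + left.I)" for t
    using mean_deviation[of "- t"] by (simp add: left_I)
qed

lemma f_bound: "\<bar>f t\<bar> \<le> L * (min_factor c (1 / I) (g t) * (\<bar>t\<bar> + 3 * I))"
  using right.f_bound[of t] left.f_bound[of "- t"]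
  by (cases "0 \<le> t") (auto simp: left_I min_factor_minus)

end

text \<open>\<open>k\<close> is the constant of (H3). Under (H2) the choice \<open>k = c2\<close>
  also qualifies, as the maximum dominates its second argument, so both parts of the theorem share
  these bounds.\<close>

locale stein_bounded = stein +
  fixes k :: real
  assumes g_diff: "\<And>x. g differentiable at x"
    and k: "\<And>x. min_factor c (1 / I) (g x) * (\<bar>x\<bar> + 3 * I) * (c * \<bar>deriv g x\<bar>) \<le> k"
begin

lemma g_deriv: "(g has_real_derivative deriv g x) (at x)"
  using g_diff[of x] by (simp add: DERIV_deriv_iff_real_differentiable)

lemma k_nonneg: "0 \<le> k"
proof -
  have "0 \<le> min_factor c (1 / I) (g 0) * (\<bar>0\<bar> + 3 * I) * (c * \<bar>deriv g 0\<bar>)"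
    using min_factor_nonneg[OF right.I_pos, of c "g 0"] right.I_pos c_pos by simp
  then show ?thesis using k[of 0] by linarith
qed

lemma f'_bound_min_factor: "\<bar>c * g t * f t + h t - m\<bar> \<le> L * (1 + k) * min_factor c (1 / I) (g t)"
proof (cases "0 \<le> t")
  case True
  then show ?thesis by (rule right.f_deriv_bound[OF _ g_diff k])
next
  case False
  have d: "((\<lambda>t. - g (- t)) has_real_derivative deriv g (- x)) (at x)" for x
    using DERIV_minus[OF DERIV_reflect[OF g_deriv[of "- x"]]] by simp
  have "\<bar>c * - g (- (- t)) * - f (- (- t)) + h (- (- t)) - m\<bar> \<le> L * (1 + k) * min_factor c (1 / left.I) (- g (- (- t)))"
  proof (rule left.f_deriv_bound)
    show "0 \<le> - t" using False by simp
    fix x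
    show "(\<lambda>t. - g (- t)) differentiable at x"
      using d[of x] by (auto simp: real_differentiable_def)
    show "min_factor c (1 / left.I) (- g (- x)) * (\<bar>x\<bar> + 3 * left.I) * (c * \<bar>deriv (\<lambda>t. - g (- t)) x\<bar>) \<le> k"
      using k[of "- x"] by (simp add: DERIV_imp_deriv[OF d] left_I min_factor_minus)
  qed
  then show ?thesis by (simp add: left_I min_factor_minus)
qed

lemma f'_bound: "\<bar>c * g t * f t + h t - m\<bar> \<le> L * (1 + k) * I"
proof -
  have "L * (1 + k) * min_factor c (1 / I) (g t) \<le> L * (1 + k) * I"
    using min_factor_le right.L_nonneg k_nonneg by (intro mult_left_mono) auto
  then show ?thesis using f'_bound_min_factor[of t] by linarith
qed

text \<open>Formally \<open>f'' = c * g' * f + c * g * f' + h'\<close>. The summands are at most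
  \<open>L * k\<close>, \<open>L * (1 + k)\<close> and \<open>L\<close>, the middle one because
  \<open>min_factor\<close> times \<open>c * \<bar>g\<bar>\<close> is at most 1; their sum is
  \<open>2 * L * (1 + k)\<close>.\<close>

lemma f'_Lipschitz:
  assumes "s \<le> t"
  shows "\<bar>(c * g t * f t + h t - m) - (c * g s * f s + h s - m)\<bar> \<le> 2 * L * (1 + k) * (t - s)"
proof -
  \<comment> \<open>The factor 1 plays the part of the weight \<open>q\<close> in the perturbation
    lemma.\<close>
  define u where "u y = 1 * ((c * g y * f y - m) + h y)" for y
  have "\<bar>u t - u s\<bar> \<le> 2 * L * (1 + k) * t - 2 * L * (1 + k) * s"
  proof (rule abs_diff_le_if_local_bound[OF \<open>s \<le> t\<close>,
        where k = "\<lambda>_. 2 * L * (1 + k)" and S = "\<lambda>x. 2 * L * (1 + k) * x" and B = u])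
    show "((\<lambda>x. 2 * L * (1 + k) * x) has_real_derivative 2 * L * (1 + k)) (at x)" for x
      by (auto intro!: derivative_eq_intros)
    fix x e :: real assume "0 < e"
    let ?d = "c * deriv g x * f x + c * g x * (c * g x * f x + h x - m)"
    show "eventually (\<lambda>y. \<bar>u y - u x\<bar> \<le> (2 * L * (1 + k) + e) * \<bar>y - x\<bar>) (at x)"
      unfolding u_def
    proof (rule local_bound_Lipschitz_perturbation[where d = ?d and L = L])
      show "((\<lambda>y. 1 * ((c * g y * f y - m) + h x)) has_real_derivative ?d) (at x)"
        using f_deriv g_deriv by (auto intro!: derivative_eq_intros simp: algebra_simps)
      have "\<bar>c * deriv g x * f x\<bar> = \<bar>f x\<bar> * (c * \<bar>deriv g x\<bar>)"
        using c_pos by (simp add: abs_mult)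
      also have "\<dots> \<le> L * (min_factor c (1 / I) (g x) * (\<bar>x\<bar> + 3 * I)) * (c * \<bar>deriv g x\<bar>)"
        using f_bound[of x] c_pos by (intro mult_right_mono) auto
      also have "\<dots> \<le> L * k"
        using mult_left_mono[OF k[of x] right.L_nonneg] by (simp add: mult.assoc)
      finally have 1: "\<bar>c * deriv g x * f x\<bar> \<le> L * k" .
      have "\<bar>c * g x * (c * g x * f x + h x - m)\<bar> = c * \<bar>g x\<bar> * \<bar>c * g x * f x + h x - m\<bar>"
        using c_pos by (simp add: abs_mult)
      also have "\<dots> \<le> c * \<bar>g x\<bar> * (L * (1 + k) * min_factor c (1 / I) (g x))"
        using f'_bound_min_factor[of x] c_pos by (intro mult_left_mono) auto
      also have "\<dots> = L * (1 + k) * (min_factor c (1 / I) (g x) * (c * \<bar>g x\<bar>))" by simp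
      also have "\<dots> \<le> L * (1 + k) * 1"
        using min_factor_mult_le[OF c_pos] right.L_nonneg k_nonneg by (intro mult_left_mono) auto
      finally have "\<bar>c * g x * (c * g x * f x + h x - m)\<bar> \<le> L * (1 + k)" by simp
      with 1 have "\<bar>?d\<bar> \<le> L * k + L * (1 + k)" by linarith
      then show "\<bar>?d\<bar> + 1 * L \<le> 2 * L * (1 + k)" by (simp add: algebra_simps)
    qed (use Lip \<open>0 < e\<close> in auto)
  qed
  then show ?thesis by (simp add: u_def algebra_simps)
qed

end

section \<open>Exchangeable pairs\<close>

text \<open>Along the segment from \<open>w\<close> to \<open>v\<close>, the quadratic
  \<open>K / 2 * d\<^sup>2 * \<tau>\<^sup>2\<close> plus or minus the remainder is nondecreasing in
  \<open>\<tau>\<close> and starts at 0.\<close>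

lemma taylor_remainder_Lipschitz_deriv:
  fixes f u :: "real \<Rightarrow> real"
  assumes deriv: "\<And>t. (f has_real_derivative u t) (at t)"
    and Lip: "\<And>s t. \<bar>u t - u s\<bar> \<le> K * \<bar>t - s\<bar>"
  shows "\<bar>f v - f w - u w * (v - w)\<bar> \<le> K / 2 * (v - w)\<^sup>2"
proof -
  define d where "d = v - w"
  have "0 \<le> K / 2 * d\<^sup>2 + \<sigma> * (f v - f w - u w * d)" if \<sigma>: "\<bar>\<sigma>\<bar> = 1" for \<sigma>
  proof -
    let ?\<psi> = "\<lambda>\<tau>. K / 2 * d\<^sup>2 * \<tau>\<^sup>2 + \<sigma> * (f (w + \<tau> * d) - f w - u w * (\<tau> * d))"
    have "?\<psi> 0 \<le> ?\<psi> 1"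
    proof (rule DERIV_nonneg_imp_nondecreasing[where f = ?\<psi>])
      fix \<tau> :: real assume \<tau>: "0 \<le> \<tau>" "\<tau> \<le> 1"
      have "((\<lambda>\<tau>. w + \<tau> * d) has_real_derivative d) (at \<tau>)"
        by (auto intro!: derivative_eq_intros)
      from DERIV_chain2[OF deriv this]
      have fd: "((\<lambda>\<tau>. f (w + \<tau> * d)) has_real_derivative u (w + \<tau> * d) * d) (at \<tau>)" .
      have "(?\<psi> has_real_derivative K * d\<^sup>2 * \<tau> + \<sigma> * ((u (w + \<tau> * d) - u w) * d)) (at \<tau>)"
        by (auto intro!: derivative_eq_intros fd simp: algebra_simps)
      moreover have "\<bar>\<sigma> * ((u (w + \<tau> * d) - u w) * d)\<bar> \<le> K * d\<^sup>2 * \<tau>"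
      proof -
        have "\<bar>\<sigma> * ((u (w + \<tau> * d) - u w) * d)\<bar> = \<bar>u (w + \<tau> * d) - u w\<bar> * \<bar>d\<bar>"
          using \<sigma> by (simp add: abs_mult)
        also have "\<dots> \<le> (K * \<bar>\<tau> * d\<bar>) * \<bar>d\<bar>"
          using Lip[of "w + \<tau> * d" w] by (intro mult_right_mono) auto
        also have "\<dots> = K * d\<^sup>2 * \<tau>"
          using \<tau> by (simp add: abs_mult power2_eq_square)
        finally show ?thesis .
      qed
      then have "0 \<le> K * d\<^sup>2 * \<tau> + \<sigma> * ((u (w + \<tau> * d) - u w) * d)" by linarith
      ultimately show "\<exists>y. (?\<psi> has_real_derivative y) (at \<tau>) \<and> 0 \<le> y" by blast
    qed simp
    then show ?thesis by (simp add: d_def)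
  qed
  from this[of 1, OF abs_one] this[of "- 1", OF abs_neg_one]
  have "\<bar>f v - f w - u w * d\<bar> \<le> K / 2 * d\<^sup>2"
    unfolding mult_1_left mult_minus1 by (intro abs_leI) linarith+
  then show ?thesis by (simp only: d_def)
qed

locale exchangeable_pair = prob_space +
  fixes W W' :: "'a \<Rightarrow> real" and \<rho> :: "real \<Rightarrow> real" and F :: "'a measure"
  assumes W [measurable]: "W \<in> borel_measurable M" and W' [measurable]: "W' \<in> borel_measurable M"
    and exch: "distr M borel (\<lambda>x. (W x, W' x)) = distr M borel (\<lambda>x. (W' x, W x))"
    and int_\<Delta>: "integrable M (\<lambda>x. W x - W' x)"
    and \<rho> [measurable]: "\<rho> \<in> borel_measurable borel"
    and F_eq: "F = vimage_algebra (space M) W borel"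
    and cond: "AE x in M. real_cond_exp M F (\<lambda>x. W x - W' x) x = \<rho> (W x)"
begin

sublocale finite_measure_subalgebra M F
proof
  show "subalgebra M F"
    unfolding F_eq subalgebra_def by (intro conjI sets_image_in_sets) simp_all
qed

lemma W_measurable_F [measurable]: "W \<in> borel_measurable F"
  unfolding F_eq by (rule measurable_vimage_algebra1) simp

lemma integral_swap:
  fixes \<phi> :: "real \<Rightarrow> real \<Rightarrow> real"
  assumes "(\<lambda>(x, y). \<phi> x y) \<in> borel_measurable borel"
  shows "(\<integral>x. \<phi> (W x) (W' x) \<partial>M) = (\<integral>x. \<phi> (W' x) (W x) \<partial>M)"
proof -
  have "(\<integral>x. \<phi> (W x) (W' x) \<partial>M) = (\<integral>z. (\<lambda>(x, y). \<phi> x y) z \<partial>distr M borel (\<lambda>x. (W x, W' x)))"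
    using assms by (subst integral_distr) auto
  also have "\<dots> = (\<integral>z. (\<lambda>(x, y). \<phi> x y) z \<partial>distr M borel (\<lambda>x. (W' x, W x)))"
    unfolding exch ..
  also have "\<dots> = (\<integral>x. \<phi> (W' x) (W x) \<partial>M)"
    using assms by (subst integral_distr) auto
  finally show ?thesis .
qed

text \<open>Swapping the pair turns the expectation of \<open>(W - W') * \<phi> W\<close> into minus
  that of \<open>(W - W') * \<phi> W'\<close>, so the two terms add up to a factor 2. Conditioning
  on \<open>W\<close> then replaces \<open>W - W'\<close> by \<open>\<rho> W\<close>.\<close>

lemma bounded_antisymmetry:
  assumes [measurable]: "\<phi> \<in> borel_measurable borel" and b: "\<And>x. \<bar>\<phi> x\<bar> \<le> b"
  shows "(\<integral>x. (W x - W' x) * (\<phi> (W x) - \<phi> (W' x)) \<partial>M) = 2 * (\<integral>x. \<phi> (W x) * \<rho> (W x) \<partial>M)"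
proof -
  have int: "integrable M (\<lambda>x. (W x - W' x) * \<phi> (V x))" if [measurable]: "V \<in> borel_measurable M" for V
  proof (rule Bochner_Integration.integrable_bound)
    show "integrable M (\<lambda>x. b * \<bar>W x - W' x\<bar>)" using int_\<Delta> by auto
    have "norm ((W x - W' x) * \<phi> (V x)) \<le> norm (b * \<bar>W x - W' x\<bar>)" for x
      using mult_left_mono[OF b[of "V x"], of "\<bar>W x - W' x\<bar>"] b[of 0] by (simp add: abs_mult mult.commute)
    then show "AE x in M. norm ((W x - W' x) * \<phi> (V x)) \<le> norm (b * \<bar>W x - W' x\<bar>)" by simp
  qed simp
  have "(\<integral>x. (W x - W' x) * \<phi> (W x) \<partial>M) = (\<integral>x. (W' x - W x) * \<phi> (W' x) \<partial>M)"
    by (rule integral_swap[of "\<lambda>x y. (x - y) * \<phi> x"]) (simp add: borel_prod[symmetric])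
  also have "\<dots> = - (\<integral>x. (W x - W' x) * \<phi> (W' x) \<partial>M)"
    by (subst Bochner_Integration.integral_minus[symmetric])
       (auto intro!: Bochner_Integration.integral_cong simp: algebra_simps)
  finally have "(\<integral>x. (W x - W' x) * (\<phi> (W x) - \<phi> (W' x)) \<partial>M) = 2 * (\<integral>x. (W x - W' x) * \<phi> (W x) \<partial>M)"
    using int[OF W] int[OF W'] by (simp add: right_diff_distrib)
  also have "(\<integral>x. (W x - W' x) * \<phi> (W x) \<partial>M) = (\<integral>x. \<phi> (W x) * (W x - W' x) \<partial>M)"
    by (simp add: mult.commute)
  also have "\<dots> = (\<integral>x. \<phi> (W x) * real_cond_exp M F (\<lambda>x. W x - W' x) x \<partial>M)"
    using int[OF W] by (intro real_cond_exp_intg(2)[symmetric]) (auto simp: mult.commute)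
  also have "\<dots> = (\<integral>x. \<phi> (W x) * \<rho> (W x) \<partial>M)"
    using cond by (intro integral_cong_AE) auto
  finally show ?thesis .
qed

text \<open>Since \<open>(W - W') \<phi>(W)\<close> may fail to be integrable, \<open>\<phi>\<close> is truncated first.\<close>

lemma antisymmetry:
  assumes [measurable]: "\<phi> \<in> borel_measurable borel"
    and int1: "integrable M (\<lambda>x. (W x - W' x) * (\<phi> (W x) - \<phi> (W' x)))"
    and int2: "integrable M (\<lambda>x. \<phi> (W x) * \<rho> (W x))"
  shows "(\<integral>x. (W x - W' x) * (\<phi> (W x) - \<phi> (W' x)) \<partial>M) = 2 * (\<integral>x. \<phi> (W x) * \<rho> (W x) \<partial>M)"
proof -
  define \<phi>n where "\<phi>n n x = max (- real n) (min (real n) (\<phi> x))" for n x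
  have [measurable]: "\<phi>n n \<in> borel_measurable borel" for n unfolding \<phi>n_def by simp
  have lim: "(\<lambda>n. \<phi>n n x) \<longlonglongrightarrow> \<phi> x" for x
  proof (rule tendsto_eventually)
    show "eventually (\<lambda>n. \<phi>n n x = \<phi> x) sequentially"
      using eventually_ge_at_top[of "nat \<lceil>\<bar>\<phi> x\<bar>\<rceil>"]
    proof eventually_elim
      case (elim n)
      then have "\<bar>\<phi> x\<bar> \<le> real n" by linarith
      then show ?case by (auto simp: \<phi>n_def)
    qed
  qed
  have lim1: "(\<lambda>n. \<integral>x. (W x - W' x) * (\<phi>n n (W x) - \<phi>n n (W' x)) \<partial>M) \<longlonglongrightarrow>
      (\<integral>x. (W x - W' x) * (\<phi> (W x) - \<phi> (W' x)) \<partial>M)"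
  proof (rule integral_dominated_convergence[where w = "\<lambda>x. \<bar>(W x - W' x) * (\<phi> (W x) - \<phi> (W' x))\<bar>"])
    show "integrable M (\<lambda>x. \<bar>(W x - W' x) * (\<phi> (W x) - \<phi> (W' x))\<bar>)" using int1 by simp
    show "AE x in M. (\<lambda>n. (W x - W' x) * (\<phi>n n (W x) - \<phi>n n (W' x))) \<longlonglongrightarrow> (W x - W' x) * (\<phi> (W x) - \<phi> (W' x))"
      by (intro AE_I2 tendsto_intros lim)
    fix n
    \<comment> \<open>Clipping to \<open>{-n..n}\<close> is a contraction, so the untruncated
      integrand dominates.\<close>
    have "\<bar>\<phi>n n (W x) - \<phi>n n (W' x)\<bar> \<le> \<bar>\<phi> (W x) - \<phi> (W' x)\<bar>" for x unfolding \<phi>n_def by linarith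
    then show "AE x in M. norm ((W x - W' x) * (\<phi>n n (W x) - \<phi>n n (W' x))) \<le> \<bar>(W x - W' x) * (\<phi> (W x) - \<phi> (W' x))\<bar>"
      by (intro AE_I2) (simp add: abs_mult mult_left_mono)
  qed simp_all
  have eq: "(\<integral>x. (W x - W' x) * (\<phi>n n (W x) - \<phi>n n (W' x)) \<partial>M) = 2 * (\<integral>x. \<phi>n n (W x) * \<rho> (W x) \<partial>M)" for n
    by (rule bounded_antisymmetry[where b = "real n"]) (auto simp: \<phi>n_def)
  have lim2: "(\<lambda>n. \<integral>x. \<phi>n n (W x) * \<rho> (W x) \<partial>M) \<longlonglongrightarrow> (\<integral>x. \<phi> (W x) * \<rho> (W x) \<partial>M)"
  proof (rule integral_dominated_convergence[where w = "\<lambda>x. \<bar>\<phi> (W x) * \<rho> (W x)\<bar>"])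
    show "integrable M (\<lambda>x. \<bar>\<phi> (W x) * \<rho> (W x)\<bar>)" using int2 by simp
    show "AE x in M. (\<lambda>n. \<phi>n n (W x) * \<rho> (W x)) \<longlonglongrightarrow> \<phi> (W x) * \<rho> (W x)"
      by (intro AE_I2 tendsto_intros lim)
    fix n
    have "\<bar>\<phi>n n (W x)\<bar> \<le> \<bar>\<phi> (W x)\<bar>" for x unfolding \<phi>n_def by linarith
    then show "AE x in M. norm (\<phi>n n (W x) * \<rho> (W x)) \<le> \<bar>\<phi> (W x) * \<rho> (W x)\<bar>"
      by (intro AE_I2) (simp add: abs_mult mult_right_mono)
  qed simp_all
  show ?thesis
    using lim1 tendsto_mult_left[OF lim2, of 2] unfolding eq by (rule LIMSEQ_unique)
qed

end

text \<open>The Stein equation, antisymmetry and Taylor expansion give the exact identity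
  \<open>decomp\<close>: the expectation of \<open>u W * (1 - c / 2 * S)\<close>, plus
  \<open>c / 2\<close> times that of the remainder \<open>R\<close>, plus \<open>c\<close> times
  that of \<open>f W * r W\<close>, with \<open>S\<close> the conditional second moment of the
  increment. The terms are then estimated separately.\<close>

lemma stein_exchangeable_bound:
  fixes f u h g r :: "real \<Rightarrow> real" and W W' :: "'a \<Rightarrow> real" and c m C K :: real
  assumes pair: "exchangeable_pair M W W' (\<lambda>t. g t + r t) F"
    and f_deriv: "\<And>t. (f has_real_derivative u t) (at t)"
    and stein: "\<And>t. u t = c * g t * f t + h t - m"
    and u_bound: "\<And>t. \<bar>u t\<bar> \<le> C"
    and u_Lip: "\<And>s t. \<bar>u t - u s\<bar> \<le> K * \<bar>t - s\<bar>"
    and "c > 0"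
    and g [measurable]: "g \<in> borel_measurable borel" and r [measurable]: "r \<in> borel_measurable borel"
    and int_h: "integrable M (\<lambda>x. h (W x))"
    and int_fr: "integrable M (\<lambda>x. f (W x) * r (W x))"
    and int3: "integrable M (\<lambda>x. \<bar>W x - W' x\<bar> ^ 3)"
  shows "\<bar>(\<integral>x. h (W x) \<partial>M) - m\<bar> \<le>
      C * (\<integral>x. \<bar>1 - (c / 2) * real_cond_exp M F (\<lambda>x. (W x - W' x)\<^sup>2) x\<bar> \<partial>M)
      + c * K / 4 * (\<integral>x. \<bar>W x - W' x\<bar> ^ 3 \<partial>M) + c * (\<integral>x. \<bar>f (W x) * r (W x)\<bar> \<partial>M)"
proof -
  interpret exchangeable_pair M W W' "\<lambda>t. g t + r t" F by fact
  let ?\<Delta> = "\<lambda>x. W x - W' x"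
  let ?R = "\<lambda>x. u (W x) * (?\<Delta> x)\<^sup>2 - ?\<Delta> x * (f (W x) - f (W' x))"
  let ?S = "\<lambda>x. real_cond_exp M F (\<lambda>x. (?\<Delta> x)\<^sup>2) x"
  have f_meas [measurable]: "f \<in> borel_measurable borel"
    using f_deriv by (intro borel_measurable_continuous_onI)
      (auto intro: continuous_at_imp_continuous_on DERIV_isCont)
  have "K-lipschitz_on UNIV u"
    using u_Lip[of 1 0] u_Lip by (auto simp: lipschitz_on_def dist_real_def)
  then have u_meas [measurable]: "u \<in> borel_measurable borel"
    by (intro borel_measurable_continuous_onI lipschitz_on_continuous_on)
  have C: "0 \<le> C" using u_bound[of 0] by linarith
  have int2: "integrable M (\<lambda>x. (?\<Delta> x)\<^sup>2)"
  proof (rule Bochner_Integration.integrable_bound)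
    show "integrable M (\<lambda>x. 1 + \<bar>?\<Delta> x\<bar> ^ 3)" using int3 by simp
    have "norm ((?\<Delta> x)\<^sup>2) \<le> norm (1 + \<bar>?\<Delta> x\<bar> ^ 3)" for x
    proof (cases "\<bar>?\<Delta> x\<bar> \<le> 1")
      case True
      then have "(?\<Delta> x)\<^sup>2 \<le> 1" by (simp add: abs_square_le_1)
      moreover have "0 \<le> \<bar>?\<Delta> x\<bar> ^ 3" by simp
      ultimately have "(?\<Delta> x)\<^sup>2 \<le> 1 + \<bar>?\<Delta> x\<bar> ^ 3" by linarith
      then show ?thesis by simp
    next
      case False
      then have "\<bar>?\<Delta> x\<bar> ^ 2 \<le> \<bar>?\<Delta> x\<bar> ^ 3" by (intro power_increasing) auto
      then show ?thesis by simp
    qed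
    then show "AE x in M. norm ((?\<Delta> x)\<^sup>2) \<le> norm (1 + \<bar>?\<Delta> x\<bar> ^ 3)" by simp
  qed simp
  have int_u: "integrable M (\<lambda>x. u (W x))"
    by (rule integrable_const_bound[of _ C]) (use u_bound in auto)
  have int_u2: "integrable M (\<lambda>x. u (W x) * (?\<Delta> x)\<^sup>2)"
  proof (rule Bochner_Integration.integrable_bound)
    show "integrable M (\<lambda>x. C * (?\<Delta> x)\<^sup>2)" using int2 by simp
    show "AE x in M. norm (u (W x) * (?\<Delta> x)\<^sup>2) \<le> norm (C * (?\<Delta> x)\<^sup>2)"
      using u_bound C by (intro AE_I2) (simp add: abs_mult mult_right_mono)
  qed simp
  have R_bound: "\<bar>?R x\<bar> \<le> K / 2 * \<bar>?\<Delta> x\<bar> ^ 3" for x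
  proof -
    \<comment> \<open>\<open>R\<close> is the increment times the first-order Taylor remainder of
      \<open>f\<close> at \<open>W\<close>, hence cubic in the increment.\<close>
    have "?R x = ?\<Delta> x * (f (W' x) - f (W x) - u (W x) * (W' x - W x))"
      by (simp add: power2_eq_square algebra_simps)
    then have "\<bar>?R x\<bar> = \<bar>?\<Delta> x\<bar> * \<bar>f (W' x) - f (W x) - u (W x) * (W' x - W x)\<bar>"
      by (simp add: abs_mult)
    also have "\<dots> \<le> \<bar>?\<Delta> x\<bar> * (K / 2 * (W' x - W x)\<^sup>2)"
      using taylor_remainder_Lipschitz_deriv[OF f_deriv u_Lip] by (intro mult_left_mono) auto
    also have "(W' x - W x)\<^sup>2 = \<bar>?\<Delta> x\<bar>\<^sup>2" by (simp add: power2_commute)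
    finally show ?thesis by (simp add: power2_eq_square power3_eq_cube mult_ac)
  qed
  have int_R: "integrable M ?R"
  proof (rule Bochner_Integration.integrable_bound)
    show "integrable M (\<lambda>x. K / 2 * \<bar>?\<Delta> x\<bar> ^ 3)" using int3 by simp
    show "AE x in M. norm (?R x) \<le> norm (K / 2 * \<bar>?\<Delta> x\<bar> ^ 3)"
      using R_bound by (intro AE_I2) (simp, smt (verit))
  qed simp
  \<comment> \<open>\<open>f\<close> may be unbounded, so integrability is read off from
    \<open>u W * \<Delta>\<^sup>2 - R\<close>.\<close>
  have int_\<Delta>f: "integrable M (\<lambda>x. ?\<Delta> x * (f (W x) - f (W' x)))"
    using Bochner_Integration.integrable_diff[OF int_u2 int_R] by simp
  \<comment> \<open>Solving the Stein equation for \<open>g * f\<close> makes it integrable from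
    \<open>u\<close> bounded and \<open>h W\<close> integrable.\<close>
  have gf: "g t * f t = (u t - h t + m) / c" for t
    using stein[of t] \<open>c > 0\<close> by (simp add: field_simps)
  have int_gf: "integrable M (\<lambda>x. g (W x) * f (W x))"
    unfolding gf using int_u int_h by simp
  have int_f\<rho>: "integrable M (\<lambda>x. f (W x) * (g (W x) + r (W x)))"
    using Bochner_Integration.integrable_add[OF int_gf int_fr] by (simp add: algebra_simps)
  have f\<rho>: "(\<integral>x. f (W x) * (g (W x) + r (W x)) \<partial>M) =
      (\<integral>x. g (W x) * f (W x) \<partial>M) + (\<integral>x. f (W x) * r (W x) \<partial>M)"
    using Bochner_Integration.integral_add[OF int_gf int_fr] by (simp add: algebra_simps)
  have anti: "(\<integral>x. ?\<Delta> x * (f (W x) - f (W' x)) \<partial>M) =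
      2 * ((\<integral>x. g (W x) * f (W x) \<partial>M) + (\<integral>x. f (W x) * r (W x) \<partial>M))"
    using antisymmetry[OF f_meas int_\<Delta>f int_f\<rho>] f\<rho> by simp
  \<comment> \<open>\<open>u W\<close> is measurable with respect to \<open>F\<close>, so the
    squared increment can be exchanged for its conditional expectation.\<close>
  have uS: "integrable M (\<lambda>x. u (W x) * ?S x)"
      "(\<integral>x. u (W x) * ?S x \<partial>M) = (\<integral>x. u (W x) * (?\<Delta> x)\<^sup>2 \<partial>M)"
    using real_cond_exp_intg[OF int_u2] by auto
  have int_S: "integrable M ?S" using int2 by (rule real_cond_exp_int)
  have "(\<integral>x. h (W x) \<partial>M) - m = (\<integral>x. h (W x) - m \<partial>M)"
    using int_h by (simp add: prob_space)
  also have "\<dots> = (\<integral>x. u (W x) - c * (g (W x) * f (W x)) \<partial>M)"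
    by (intro Bochner_Integration.integral_cong) (simp_all add: stein)
  also have "\<dots> = (\<integral>x. u (W x) \<partial>M) - c * (\<integral>x. g (W x) * f (W x) \<partial>M)"
    using int_u int_gf by simp
  also have "\<dots> = (\<integral>x. u (W x) \<partial>M) - c / 2 * (\<integral>x. u (W x) * (?\<Delta> x)\<^sup>2 \<partial>M)
      + c / 2 * ((\<integral>x. u (W x) * (?\<Delta> x)\<^sup>2 \<partial>M) - (\<integral>x. ?\<Delta> x * (f (W x) - f (W' x)) \<partial>M))
      + c * (\<integral>x. f (W x) * r (W x) \<partial>M)"
    unfolding anti by (simp add: algebra_simps)
  also have "(\<integral>x. u (W x) * (?\<Delta> x)\<^sup>2 \<partial>M) - (\<integral>x. ?\<Delta> x * (f (W x) - f (W' x)) \<partial>M) = (\<integral>x. ?R x \<partial>M)"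
    using int_u2 int_\<Delta>f by simp
  also have "(\<integral>x. u (W x) \<partial>M) - c / 2 * (\<integral>x. u (W x) * (?\<Delta> x)\<^sup>2 \<partial>M) = (\<integral>x. u (W x) * (1 - c / 2 * ?S x) \<partial>M)"
  proof -
    have "(\<integral>x. u (W x) * (1 - c / 2 * ?S x) \<partial>M) = (\<integral>x. u (W x) - c / 2 * (u (W x) * ?S x) \<partial>M)"
      by (intro Bochner_Integration.integral_cong) (simp_all add: algebra_simps)
    also have "\<dots> = (\<integral>x. u (W x) \<partial>M) - c / 2 * (\<integral>x. u (W x) * ?S x \<partial>M)"
      using int_u uS(1) by simp
    finally show ?thesis unfolding uS(2) by simp
  qed
  finally have decomp: "(\<integral>x. h (W x) \<partial>M) - m = (\<integral>x. u (W x) * (1 - c / 2 * ?S x) \<partial>M)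
      + c / 2 * (\<integral>x. ?R x \<partial>M) + c * (\<integral>x. f (W x) * r (W x) \<partial>M)" .
  have "\<bar>\<integral>x. u (W x) * (1 - c / 2 * ?S x) \<partial>M\<bar> \<le> (\<integral>x. \<bar>u (W x) * (1 - c / 2 * ?S x)\<bar> \<partial>M)"
    by (rule integral_abs_bound)
  also have "\<dots> \<le> (\<integral>x. C * \<bar>1 - c / 2 * ?S x\<bar> \<partial>M)"
  proof (rule integral_mono)
    have "integrable M (\<lambda>x. u (W x) - c / 2 * (u (W x) * ?S x))" using int_u uS(1) by simp
    then have "integrable M (\<lambda>x. u (W x) * (1 - c / 2 * ?S x))" by (simp add: algebra_simps)
    then show "integrable M (\<lambda>x. \<bar>u (W x) * (1 - c / 2 * ?S x)\<bar>)" by simp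
    show "integrable M (\<lambda>x. C * \<bar>1 - c / 2 * ?S x\<bar>)" using int_S by simp
    show "\<bar>u (W x) * (1 - c / 2 * ?S x)\<bar> \<le> C * \<bar>1 - c / 2 * ?S x\<bar>" for x
      using u_bound by (simp add: abs_mult mult_right_mono)
  qed
  finally have 1: "\<bar>\<integral>x. u (W x) * (1 - c / 2 * ?S x) \<partial>M\<bar> \<le> C * (\<integral>x. \<bar>1 - c / 2 * ?S x\<bar> \<partial>M)" by simp
  have "\<bar>\<integral>x. ?R x \<partial>M\<bar> \<le> (\<integral>x. \<bar>?R x\<bar> \<partial>M)" by (rule integral_abs_bound)
  also have "\<dots> \<le> (\<integral>x. K / 2 * \<bar>?\<Delta> x\<bar> ^ 3 \<partial>M)"
    using int_R int3 R_bound by (intro integral_mono) auto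
  finally have "\<bar>\<integral>x. ?R x \<partial>M\<bar> \<le> K / 2 * (\<integral>x. \<bar>?\<Delta> x\<bar> ^ 3 \<partial>M)" by simp
  \<comment> \<open>The constant \<open>c * K / 4\<close> is \<open>c / 2\<close> from the identity
    times \<open>K / 2\<close> from the Taylor remainder.\<close>
  from mult_left_mono[OF this, of "c / 2"] \<open>c > 0\<close>
  have 2: "\<bar>c / 2 * (\<integral>x. ?R x \<partial>M)\<bar> \<le> c * K / 4 * (\<integral>x. \<bar>?\<Delta> x\<bar> ^ 3 \<partial>M)"
    by (simp add: abs_mult)
  have 3: "\<bar>c * (\<integral>x. f (W x) * r (W x) \<partial>M)\<bar> \<le> c * (\<integral>x. \<bar>f (W x) * r (W x)\<bar> \<partial>M)"
    using integral_abs_bound[of M "\<lambda>x. f (W x) * r (W x)"] \<open>c > 0\<close> by (simp add: abs_mult)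
  show ?thesis unfolding decomp using 1 2 3 by linarith
qed

section \<open>Assembly of the two bounds\<close>

theorem theorem1p1:
  fixes M :: "'a measure" and W W' :: "'a \<Rightarrow> real"
    and g r h h' :: "real \<Rightarrow> real" and c0 :: real
    and N :: "'b measure" and Y :: "'b \<Rightarrow> real"
  defines "\<Delta> \<equiv> (\<lambda>x. W x - W' x)"
  defines "F \<equiv> vimage_algebra (space M) W borel"
  defines "G \<equiv> (\<lambda>t. LBINT s=0..t. g s)"
  defines "c1 \<equiv> 1 / (\<integral>t. exp (- c0 * G t) \<partial>lborel)"
  defines "p \<equiv> (\<lambda>t. c1 * exp (- c0 * G t))"
  defines "nh' \<equiv> (SUP x. \<bar>h' x\<bar>)"
  assumes M: "prob_space M"
    and W: "W \<in> borel_measurable M" and W': "W' \<in> borel_measurable M"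
    and exch: "distr M borel (\<lambda>x. (W x, W' x)) = distr M borel (\<lambda>x. (W' x, W x))"
    and int_\<Delta>: "integrable M \<Delta>"
    and g_diff: "\<And>x. g differentiable (at x)"
    and r_meas: "r \<in> borel_measurable borel"
    and cond: "AE x in M. real_cond_exp M F \<Delta> x = g (W x) + r (W x)"
    and c0: "c0 > 0"
    and int_exp: "integrable lborel (\<lambda>t. exp (- c0 * G t))"
    and N: "prob_space N"
    and Y: "distributed N lborel Y (\<lambda>t. ennreal (p t))"
    and h_ac: "abs_cont h"
    and h'_deriv: "AE x in lborel. (h has_real_derivative h' x) (at x)"
    and h'_bdd: "bdd_above (range (\<lambda>x. \<bar>h' x\<bar>))"
    and int_hW: "integrable M (\<lambda>x. h (W x))"
    and int_\<Delta>3: "integrable M (\<lambda>x. \<bar>\<Delta> x\<bar> ^ 3)"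
    and H1: "mono g" "\<And>t. t > 0 \<Longrightarrow> g t \<ge> 0" "\<And>t. t \<le> 0 \<Longrightarrow> g t \<le> 0"
  shows
    "(integrable M (\<lambda>x. r (W x)) \<longrightarrow> (\<forall>c2. (\<forall>x. min_factor c0 c1 (g x) * (\<bar>x\<bar> + 3 / c1) * max 1 (c0 * \<bar>deriv g x\<bar>) \<le> c2)
       \<longrightarrow> \<bar>(\<integral>x. h (W x) \<partial>M) - (\<integral>y. h (Y y) \<partial>N)\<bar>
           \<le> nh' * ((1 + c2) / c1 * (\<integral>x. \<bar>1 - (c0 / 2) * real_cond_exp M F (\<lambda>z. (\<Delta> z)\<^sup>2) x\<bar> \<partial>M)
                   + 1/2 * c0 * (1 + c2) * (\<integral>x. \<bar>\<Delta> x\<bar> ^ 3 \<partial>M)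
                   + c0 * c2 * (\<integral>x. \<bar>r (W x)\<bar> \<partial>M))))
   \<and> (integrable M (\<lambda>x. (\<bar>W x\<bar> + 3 / c1) * \<bar>r (W x)\<bar>) \<longrightarrow> (\<forall>c3. (\<forall>x. min_factor c0 c1 (g x) * (\<bar>x\<bar> + 3 / c1) * (c0 * \<bar>deriv g x\<bar>) \<le> c3)
       \<longrightarrow> \<bar>(\<integral>x. h (W x) \<partial>M) - (\<integral>y. h (Y y) \<partial>N)\<bar>
           \<le> nh' * ((1 + c3) / c1 * (\<integral>x. \<bar>1 - (c0 / 2) * real_cond_exp M F (\<lambda>z. (\<Delta> z)\<^sup>2) x\<bar> \<partial>M)
                   + 1/2 * c0 * (1 + c3) * (\<integral>x. \<bar>\<Delta> x\<bar> ^ 3 \<partial>M)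
                   + c0 / c1 * (\<integral>x. (\<bar>W x\<bar> + 3 / c1) * \<bar>r (W x)\<bar> \<partial>M))))"
proof -
  define E where "E t = exp (- c0 * G t)" for t
  have g_cont: "isCont g x" for x
    using g_diff[of x] by (rule differentiable_imp_continuous_within)
  have G_deriv: "((\<lambda>t. G (ereal t)) has_real_derivative g t) (at t)" for t
    unfolding G_def zero_ereal_def by (rule interval_integral_has_real_derivative[OF g_cont])
  \<comment> \<open>(H1) gives only \<open>g 0 <= 0\<close> at the origin; nonnegativity there
    follows by continuity from the right.\<close>
  have "(g \<longlongrightarrow> g 0) (at_right 0)"
    using g_cont[of 0] by (simp add: isCont_def filterlim_at_split)
  then have g0: "0 \<le> g 0"
    by (rule tendsto_lowerbound)
       (auto intro: eventually_mono[OF eventually_at_right_less] H1(2))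
  have G_0: "G (ereal 0) = 0" by (simp add: G_def zero_ereal_def)
  interpret gibbs c0 g E
  proof
    show "(E has_real_derivative - c0 * g t * E t) (at t)" for t
      unfolding E_def using G_deriv by (auto intro!: derivative_eq_intros)
    show "0 \<le> g t" if "0 \<le> t" for t using that H1(2)[of t] g0 by (cases "t = 0") auto
    show "integrable lborel E" using int_exp by (simp add: E_def[abs_def])
  qed (use c0 H1 G_0 in \<open>auto simp: E_def\<close>)
  have c1: "c1 = 1 / right.I"
    unfolding c1_def right.I_def by (simp add: E_def)
  have "\<bar>h' x\<bar> \<le> nh'" for x
    unfolding nh'_def using h'_bdd by (rule cSUP_upper2[OF _ UNIV_I order_refl])
  from abs_cont_Lipschitz[OF h_ac h'_deriv this]
  interpret stein c0 g E h nh'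
    by unfold_locales
  have h_meas: "h \<in> borel_measurable borel"
    using Lip_isCont by (intro borel_measurable_continuous_onI) (auto intro: continuous_at_imp_continuous_on)
  have mean: "(\<integral>y. h (Y y) \<partial>N) = m"
  proof -
    have "(\<integral>y. h (Y y) \<partial>N) = (\<integral>x. p x * h x \<partial>lborel)"
      using h_meas right.I_pos by (intro distributed_integral[OF Y, symmetric]) (auto simp: p_def c1)
    also have "\<dots> = (\<integral>x. c1 * (h x * E x) \<partial>lborel)"
      by (simp add: p_def E_def mult_ac)
    also have "\<dots> = m" by (simp add: m_def c1)
    finally show ?thesis .
  qed
  have g_meas: "g \<in> borel_measurable borel"
    using H1(1) by (rule borel_measurable_mono)
  have f_meas: "f \<in> borel_measurable borel"
    using f_deriv by (intro borel_measurable_continuous_onI)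
      (auto intro: continuous_at_imp_continuous_on DERIV_isCont)
  have fr_meas: "(\<lambda>x. f (W x) * r (W x)) \<in> borel_measurable M"
    using f_meas r_meas W by measurable
  have pair: "exchangeable_pair M W W' (\<lambda>t. g t + r t) F"
    unfolding exchangeable_pair_def exchangeable_pair_axioms_def
    using M W W' exch int_\<Delta> g_meas r_meas cond by (auto simp: \<Delta>_def F_def)
  define A where "A = (\<integral>x. \<bar>1 - (c0 / 2) * real_cond_exp M F (\<lambda>z. (\<Delta> z)\<^sup>2) x\<bar> \<partial>M)"
  define D where "D = (\<integral>x. \<bar>\<Delta> x\<bar> ^ 3 \<partial>M)"
  \<comment> \<open>The two parts differ only in the dominating variable \<open>q\<close> for
    \<open>f W * r W\<close>; everything else is proved once, with \<open>k\<close> standing for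
    \<open>c2\<close> or \<open>c3\<close>.\<close>
  have core: "\<bar>(\<integral>x. h (W x) \<partial>M) - (\<integral>y. h (Y y) \<partial>N)\<bar> \<le>
      nh' * ((1 + k) / c1 * A + 1 / 2 * c0 * (1 + k) * D + b)"
    if k: "\<And>x. min_factor c0 (1 / right.I) (g x) * (\<bar>x\<bar> + 3 * right.I) * (c0 * \<bar>deriv g x\<bar>) \<le> k"
      and q_int: "integrable M q" and q: "\<And>x. \<bar>f (W x) * r (W x)\<bar> \<le> nh' * q x"
      and b: "c0 * (\<integral>x. q x \<partial>M) = b" for k b q
  proof -
    interpret stein_bounded c0 g E h nh' k
      by unfold_locales (fact g_diff k)+
    have int_fr: "integrable M (\<lambda>x. f (W x) * r (W x))"
    proof (rule Bochner_Integration.integrable_bound)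
      show "integrable M (\<lambda>x. nh' * q x)" using q_int by simp
      show "AE x in M. norm (f (W x) * r (W x)) \<le> norm (nh' * q x)"
        using q by (intro AE_I2) (simp, smt (verit))
    qed (rule fr_meas)
    have Lip': "\<bar>(c0 * g t * f t + h t - m) - (c0 * g s * f s + h s - m)\<bar> \<le> 2 * nh' * (1 + k) * \<bar>t - s\<bar>" for s t
      using f'_Lipschitz[of s t] f'_Lipschitz[of t s] by (cases "s \<le> t") (auto simp: abs_minus_commute)
    have "\<bar>(\<integral>x. h (W x) \<partial>M) - m\<bar> \<le> nh' * (1 + k) * right.I * A
        + c0 * (2 * nh' * (1 + k)) / 4 * D + c0 * (\<integral>x. \<bar>f (W x) * r (W x)\<bar> \<partial>M)"
      using stein_exchangeable_bound[OF pair f_deriv refl f'_bound Lip' c0 g_meas r_meas int_hW int_fr]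
        int_\<Delta>3 unfolding A_def D_def \<Delta>_def by simp
    also have "(\<integral>x. \<bar>f (W x) * r (W x)\<bar> \<partial>M) \<le> (\<integral>x. nh' * q x \<partial>M)"
      using int_fr q_int q by (intro integral_mono) auto
    finally have "\<bar>(\<integral>x. h (W x) \<partial>M) - m\<bar> \<le> nh' * (1 + k) * right.I * A
        + c0 * (2 * nh' * (1 + k)) / 4 * D + c0 * (nh' * (\<integral>x. q x \<partial>M))"
      using c0 by (simp add: mult_left_mono)
    \<comment> \<open>\<open>right.I\<close> becomes \<open>1 / c1\<close>, and the Lipschitz
      constant \<open>2 * nh' * (1 + k)\<close> divided by 4 yields the factor one half.\<close>
    also have "\<dots> = nh' * ((1 + k) / c1 * A + 1 / 2 * c0 * (1 + k) * D + b)"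
      unfolding b[symmetric] by (simp add: c1 algebra_simps)
    finally show ?thesis unfolding mean .
  qed
  have mf_nonneg: "0 \<le> min_factor c0 (1 / right.I) (g x) * (\<bar>x\<bar> + 3 * right.I)" for x
    using min_factor_nonneg[OF right.I_pos] right.I_pos by simp
  show ?thesis
  proof (intro conjI impI allI)
    fix c2
    assume int_r: "integrable M (\<lambda>x. r (W x))"
      and H2: "\<forall>x. min_factor c0 c1 (g x) * (\<bar>x\<bar> + 3 / c1) * max 1 (c0 * \<bar>deriv g x\<bar>) \<le> c2"
    have H2': "min_factor c0 (1 / right.I) (g x) * (\<bar>x\<bar> + 3 * right.I) * max 1 (c0 * \<bar>deriv g x\<bar>) \<le> c2" for x
      using H2[rule_format, of x] by (simp add: c1)
    show "\<bar>(\<integral>x. h (W x) \<partial>M) - (\<integral>y. h (Y y) \<partial>N)\<bar>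
           \<le> nh' * ((1 + c2) / c1 * (\<integral>x. \<bar>1 - (c0 / 2) * real_cond_exp M F (\<lambda>z. (\<Delta> z)\<^sup>2) x\<bar> \<partial>M)
                   + 1/2 * c0 * (1 + c2) * (\<integral>x. \<bar>\<Delta> x\<bar> ^ 3 \<partial>M)
                   + c0 * c2 * (\<integral>x. \<bar>r (W x)\<bar> \<partial>M))"
      unfolding A_def[symmetric] D_def[symmetric]
    \<comment> \<open>The maximum in (H2) is used twice: its second argument bounds the term with
      \<open>deriv g\<close>, while its first argument 1 gives the uniform bound
      \<open>nh' * c2\<close> on \<open>f\<close>.\<close>
    proof (rule core[where q = "\<lambda>x. c2 * \<bar>r (W x)\<bar>"])
      fix x
      show "min_factor c0 (1 / right.I) (g x) * (\<bar>x\<bar> + 3 * right.I) * (c0 * \<bar>deriv g x\<bar>) \<le> c2"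
        using H2'[of x] mult_left_mono[OF max.cobounded2 mf_nonneg[of x], of "c0 * \<bar>deriv g x\<bar>" 1]
        by linarith
    next
      fix x
      have "min_factor c0 (1 / right.I) (g (W x)) * (\<bar>W x\<bar> + 3 * right.I) \<le> c2"
        using H2'[of "W x"] mult_left_mono[OF max.cobounded1 mf_nonneg[of "W x"], of 1 "c0 * \<bar>deriv g (W x)\<bar>"]
        by linarith
      then have "nh' * (min_factor c0 (1 / right.I) (g (W x)) * (\<bar>W x\<bar> + 3 * right.I)) \<le> nh' * c2"
        using right.L_nonneg by (rule mult_left_mono)
      then have "\<bar>f (W x)\<bar> \<le> nh' * c2" using f_bound[of "W x"] by linarith
      then have "\<bar>f (W x)\<bar> * \<bar>r (W x)\<bar> \<le> nh' * c2 * \<bar>r (W x)\<bar>" by (rule mult_right_mono) simp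
      then show "\<bar>f (W x) * r (W x)\<bar> \<le> nh' * (c2 * \<bar>r (W x)\<bar>)" by (simp add: abs_mult mult.assoc)
    qed (use int_r in simp_all)
  next
    fix c3
    assume int_r: "integrable M (\<lambda>x. (\<bar>W x\<bar> + 3 / c1) * \<bar>r (W x)\<bar>)"
      and H3: "\<forall>x. min_factor c0 c1 (g x) * (\<bar>x\<bar> + 3 / c1) * (c0 * \<bar>deriv g x\<bar>) \<le> c3"
    show "\<bar>(\<integral>x. h (W x) \<partial>M) - (\<integral>y. h (Y y) \<partial>N)\<bar>
           \<le> nh' * ((1 + c3) / c1 * (\<integral>x. \<bar>1 - (c0 / 2) * real_cond_exp M F (\<lambda>z. (\<Delta> z)\<^sup>2) x\<bar> \<partial>M)
                   + 1/2 * c0 * (1 + c3) * (\<integral>x. \<bar>\<Delta> x\<bar> ^ 3 \<partial>M)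
                   + c0 / c1 * (\<integral>x. (\<bar>W x\<bar> + 3 / c1) * \<bar>r (W x)\<bar> \<partial>M))"
      unfolding A_def[symmetric] D_def[symmetric]
    \<comment> \<open>For (H3) \<open>min_factor\<close> is estimated by \<open>1 / c1\<close>,
      which leaves a bound on \<open>f\<close> of linear growth and hence the weight
      \<open>\<bar>W\<bar> + 3 / c1\<close> on \<open>r W\<close>.\<close>
    proof (rule core[where q = "\<lambda>x. 1 / c1 * ((\<bar>W x\<bar> + 3 / c1) * \<bar>r (W x)\<bar>)"])
      show "min_factor c0 (1 / right.I) (g x) * (\<bar>x\<bar> + 3 * right.I) * (c0 * \<bar>deriv g x\<bar>) \<le> c3" for x
        using H3[rule_format, of x] by (simp add: c1)
      show "integrable M (\<lambda>x. 1 / c1 * ((\<bar>W x\<bar> + 3 / c1) * \<bar>r (W x)\<bar>))"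
        using int_r by (rule integrable_mult_right)
      show "c0 * (\<integral>x. 1 / c1 * ((\<bar>W x\<bar> + 3 / c1) * \<bar>r (W x)\<bar>) \<partial>M) =
          c0 / c1 * (\<integral>x. (\<bar>W x\<bar> + 3 / c1) * \<bar>r (W x)\<bar> \<partial>M)"
        by (subst integral_mult_right_zero) simp
    next
      fix x
      have "min_factor c0 (1 / right.I) (g (W x)) * (\<bar>W x\<bar> + 3 * right.I) \<le> right.I * (\<bar>W x\<bar> + 3 * right.I)"
        using right.I_pos by (intro mult_right_mono min_factor_le) auto
      then have "nh' * (min_factor c0 (1 / right.I) (g (W x)) * (\<bar>W x\<bar> + 3 * right.I)) \<le>
          nh' * (right.I * (\<bar>W x\<bar> + 3 * right.I))"
        using right.L_nonneg by (rule mult_left_mono)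
      then have "\<bar>f (W x)\<bar> \<le> nh' * (right.I * (\<bar>W x\<bar> + 3 * right.I))" using f_bound[of "W x"] by linarith
      then have "\<bar>f (W x)\<bar> * \<bar>r (W x)\<bar> \<le> nh' * (right.I * (\<bar>W x\<bar> + 3 * right.I)) * \<bar>r (W x)\<bar>"
        by (rule mult_right_mono) simp
      then show "\<bar>f (W x) * r (W x)\<bar> \<le> nh' * (1 / c1 * ((\<bar>W x\<bar> + 3 / c1) * \<bar>r (W x)\<bar>))"
        by (simp add: abs_mult mult.assoc c1)
    qed
  qed
qed

end
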